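(* Let $k$ be a field of characteristic $3$ and let $R$ be the localization at the ideal $(x_1,\ldots,x_4)$ of the ring $$\frac{k[x_1,\ldots,x_4]}{(x_1^7+x_2^7+x_3^7+x_4^7)}.$$ Then the test ideal $\tau$ of $R$ is the ideal generated by the elements $x_i^2x_j^2$ for all $1\le i,j\le 4$ (the case $i=j$ included).
   Context: Let $R$ be a commutative Noetherian ring of prime characteristic $p>0$; the letter $q$ always denotes a power $p^e$, $e\in\mathbb{N}$. For an ideal $I\subseteq R$, $I^{[q]}$ is the ideal generated by the $q$th powers of all elements of $I$. An element $u\in R$ is in the tight closure $I^*$ of $I$ if there exists $c\in R$, not in any minimal prime of $R$, such that $cu^q\in I^{[q]}$ for all large $q=p^e$. The test ideal $\tau$ of $R$ is the ideal of all $c\in R$ such that for every ideal $I\subseteq R$ and every $u\in I^*$ one has $cu^q\in I^{[q]}$ for all $q=p^e$. *)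

theory Defs
  imports
    "HOL-Library.Poly_Mapping"
    "HOL-Library.Numeral_Type"
    "HOL-Algebra.QuotRing"
    "HOL-Algebra.Algebraic_Closure_Type"
begin

section \<open>Tight closure and the test ideal\<close>

definition minimal_prime :: "('a, 'b) ring_scheme \<Rightarrow> 'a set \<Rightarrow> bool" where
  "minimal_prime R P \<longleftrightarrow>
     primeideal P R \<and> (\<forall>Q. primeideal Q R \<and> Q \<subseteq> P \<longrightarrow> Q = P)"

definition bracket_power :: "('a, 'b) ring_scheme \<Rightarrow> 'a set \<Rightarrow> nat \<Rightarrow> 'a set" where
  "bracket_power R I q = Idl\<^bsub>R\<^esub> {u [^]\<^bsub>R\<^esub> q | u. u \<in> I}"

text \<open>In the next two definitions \<open>p\<close> is the prime characteristic of \<open>R\<close>.\<close>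

definition tight_closure :: "nat \<Rightarrow> ('a, 'b) ring_scheme \<Rightarrow> 'a set \<Rightarrow> 'a set" where
  "tight_closure p R I =
     {u \<in> carrier R. \<exists>c \<in> carrier R. (\<forall>P. minimal_prime R P \<longrightarrow> c \<notin> P) \<and>
        (\<exists>e\<^sub>0. \<forall>e\<ge>e\<^sub>0. c \<otimes>\<^bsub>R\<^esub> u [^]\<^bsub>R\<^esub> (p ^ e) \<in> bracket_power R I (p ^ e))}"

text \<open>The exponent \<open>e = 0\<close>, i.e. \<open>q = 1\<close>, is included.\<close>

definition test_ideal :: "nat \<Rightarrow> ('a, 'b) ring_scheme \<Rightarrow> 'a set" where
  "test_ideal p R =
     {c \<in> carrier R. \<forall>I. ideal I R \<longrightarrow> (\<forall>u \<in> tight_closure p R I. \<forall>e.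
        c \<otimes>\<^bsub>R\<^esub> u [^]\<^bsub>R\<^esub> (p ^ e) \<in> bracket_power R I (p ^ e))}"


section \<open>Localization of a commutative ring at a multiplicative set\<close>

definition loc_rel :: "('a, 'b) ring_scheme \<Rightarrow> 'a set \<Rightarrow> (('a \<times> 'a) \<times> ('a \<times> 'a)) set" where
  "loc_rel R S =
     {((a, s), (b, t)). a \<in> carrier R \<and> s \<in> S \<and> b \<in> carrier R \<and> t \<in> S \<and>
        (\<exists>v \<in> S. v \<otimes>\<^bsub>R\<^esub> (a \<otimes>\<^bsub>R\<^esub> t) = v \<otimes>\<^bsub>R\<^esub> (b \<otimes>\<^bsub>R\<^esub> s))}"

definition loc_frac :: "('a, 'b) ring_scheme \<Rightarrow> 'a set \<Rightarrow> 'a \<Rightarrow> 'a \<Rightarrow> ('a \<times> 'a) set" where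
  "loc_frac R S a s = loc_rel R S `` {(a, s)}"

definition localization :: "('a, 'b) ring_scheme \<Rightarrow> 'a set \<Rightarrow> ('a \<times> 'a) set ring" where
  "localization R S =
     \<lparr>carrier = (carrier R \<times> S) // loc_rel R S,
      monoid.mult = (\<lambda>F G. \<Union>(a, s) \<in> F. \<Union>(b, t) \<in> G.
                loc_frac R S (a \<otimes>\<^bsub>R\<^esub> b) (s \<otimes>\<^bsub>R\<^esub> t)),
      one = loc_frac R S \<one>\<^bsub>R\<^esub> \<one>\<^bsub>R\<^esub>,
      ring.zero = loc_frac R S \<zero>\<^bsub>R\<^esub> \<one>\<^bsub>R\<^esub>,
      add = (\<lambda>F G. \<Union>(a, s) \<in> F. \<Union>(b, t) \<in> G.
                loc_frac R S (a \<otimes>\<^bsub>R\<^esub> t \<oplus>\<^bsub>R\<^esub> b \<otimes>\<^bsub>R\<^esub> s) (s \<otimes>\<^bsub>R\<^esub> t))\<rparr>"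

text \<open>Used for a prime ideal \<open>P\<close>.\<close>

definition localization_at :: "('a, 'b) ring_scheme \<Rightarrow> 'a set \<Rightarrow> ('a \<times> 'a) set ring" where
  "localization_at R P = localization R (carrier R - P)"

locale loc_data = cring R for R (structure) +
  fixes S
  assumes sub: "S \<subseteq> carrier R" and one_S: "\<one> \<in> S"
    and mult_S: "\<And>s t. s \<in> S \<Longrightarrow> t \<in> S \<Longrightarrow> s \<otimes> t \<in> S"
begin

lemma S_carr [simp]: "s \<in> S \<Longrightarrow> s \<in> carrier R"
  using sub by auto

lemma equiv_loc_rel: "equiv (carrier R \<times> S) (loc_rel R S)"
proof (rule equivI)
  show "loc_rel R S \<subseteq> (carrier R \<times> S) \<times> (carrier R \<times> S)"
    unfolding loc_rel_def by auto
  show "refl_on (carrier R \<times> S) (loc_rel R S)"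
    unfolding refl_on_def loc_rel_def using one_S by auto
  show "sym (loc_rel R S)"
    unfolding sym_def loc_rel_def by (auto, metis)
  show "trans (loc_rel R S)"
  proof (rule transI)
    fix x y z assume "(x, y) \<in> loc_rel R S" "(y, z) \<in> loc_rel R S"
    then obtain a s b t c r v w where *: "x = (a, s)" "y = (b, t)" "z = (c, r)"
      "a \<in> carrier R" "b \<in> carrier R" "c \<in> carrier R" "s \<in> S" "t \<in> S" "r \<in> S" "v \<in> S" "w \<in> S"
      "v \<otimes> (a \<otimes> t) = v \<otimes> (b \<otimes> s)" "w \<otimes> (b \<otimes> r) = w \<otimes> (c \<otimes> t)"
      unfolding loc_rel_def by auto
    note [simp] = *(4-11)
    have "(v \<otimes> w \<otimes> t) \<otimes> (a \<otimes> r) = (w \<otimes> r) \<otimes> (v \<otimes> (a \<otimes> t))" by (simp add: m_ac)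
    also have "\<dots> = (v \<otimes> s) \<otimes> (w \<otimes> (b \<otimes> r))" unfolding *(12) by (simp add: m_ac)
    also have "\<dots> = (v \<otimes> w \<otimes> t) \<otimes> (c \<otimes> s)" unfolding *(13) by (simp add: m_ac)
    finally show "(x, z) \<in> loc_rel R S"
      unfolding loc_rel_def *(1-3) using mult_S by auto
  qed
qed

lemma loc_frac_eq_iff:
  assumes "a \<in> carrier R" "s \<in> S" "b \<in> carrier R" "t \<in> S"
  shows "loc_frac R S a s = loc_frac R S b t \<longleftrightarrow> (\<exists>v \<in> S. v \<otimes> (a \<otimes> t) = v \<otimes> (b \<otimes> s))"
proof -
  have "loc_frac R S a s = loc_frac R S b t \<longleftrightarrow> ((a, s), (b, t)) \<in> loc_rel R S"
    unfolding loc_frac_def by (rule eq_equiv_class_iff[OF equiv_loc_rel]) (use assms in auto)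
  then show ?thesis using assms by (auto simp: loc_rel_def)
qed

lemma loc_carrierE:
  assumes "F \<in> carrier (localization R S)"
  obtains a s where "F = loc_frac R S a s" "a \<in> carrier R" "s \<in> S"
  using assms unfolding localization_def loc_frac_def by (auto elim!: quotientE)

lemma loc_frac_carrier:
  "a \<in> carrier R \<Longrightarrow> s \<in> S \<Longrightarrow> loc_frac R S a s \<in> carrier (localization R S)"
  unfolding localization_def loc_frac_def by (auto intro: quotientI)

lemma loc_UN:
  assumes "\<And>a s b t a' s' b' t'. ((a, s), (a', s')) \<in> loc_rel R S \<Longrightarrow>
      ((b, t), (b', t')) \<in> loc_rel R S \<Longrightarrow> f a s b t = f a' s' b' t'"
    and "a \<in> carrier R" "s \<in> S" "b \<in> carrier R" "t \<in> S"
  shows "(\<Union>(a, s) \<in> loc_frac R S a s. \<Union>(b, t) \<in> loc_frac R S b t. f a s b t) = f a s b t"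
proof -
  have "congruent2 (loc_rel R S) (loc_rel R S) (\<lambda>(a, s) (b, t). f a s b t)"
    using assms(1) unfolding congruent2_def by auto
  from UN_equiv_class2[OF equiv_loc_rel equiv_loc_rel this, of "(a, s)" "(b, t)"] assms
  show ?thesis unfolding loc_frac_def by (simp add: case_prod_unfold)
qed

lemma loc_mult:
  assumes "a \<in> carrier R" "s \<in> S" "b \<in> carrier R" "t \<in> S"
  shows "loc_frac R S a s \<otimes>\<^bsub>localization R S\<^esub> loc_frac R S b t = loc_frac R S (a \<otimes> b) (s \<otimes> t)"
proof -
  have "loc_frac R S (a \<otimes> b) (s \<otimes> t) = loc_frac R S (a' \<otimes> b') (s' \<otimes> t')"
    if "((a, s), (a', s')) \<in> loc_rel R S" "((b, t), (b', t')) \<in> loc_rel R S"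
    for a s b t a' s' b' t'
  proof -
    from that obtain v w where *:
      "a \<in> carrier R" "a' \<in> carrier R" "b \<in> carrier R" "b' \<in> carrier R"
      "s \<in> S" "s' \<in> S" "t \<in> S" "t' \<in> S" "v \<in> S" "w \<in> S"
      "v \<otimes> (a \<otimes> s') = v \<otimes> (a' \<otimes> s)" "w \<otimes> (b \<otimes> t') = w \<otimes> (b' \<otimes> t)"
      unfolding loc_rel_def by auto
    note [simp] = *(1-10)
    have "(v \<otimes> w) \<otimes> ((a \<otimes> b) \<otimes> (s' \<otimes> t')) = (v \<otimes> (a \<otimes> s')) \<otimes> (w \<otimes> (b \<otimes> t'))"
      by (simp add: m_ac)
    also have "\<dots> = (v \<otimes> w) \<otimes> ((a' \<otimes> b') \<otimes> (s \<otimes> t))"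
      unfolding *(11,12) by (simp add: m_ac)
    finally show ?thesis
      using mult_S by (subst loc_frac_eq_iff) auto
  qed
  from loc_UN[where f = "\<lambda>a s b t. loc_frac R S (a \<otimes> b) (s \<otimes> t)", OF this assms]
  show ?thesis unfolding localization_def by simp
qed

lemma loc_add:
  assumes "a \<in> carrier R" "s \<in> S" "b \<in> carrier R" "t \<in> S"
  shows "loc_frac R S a s \<oplus>\<^bsub>localization R S\<^esub> loc_frac R S b t =
           loc_frac R S (a \<otimes> t \<oplus> b \<otimes> s) (s \<otimes> t)"
proof -
  have "loc_frac R S (a \<otimes> t \<oplus> b \<otimes> s) (s \<otimes> t) = loc_frac R S (a' \<otimes> t' \<oplus> b' \<otimes> s') (s' \<otimes> t')"
    if "((a, s), (a', s')) \<in> loc_rel R S" "((b, t), (b', t')) \<in> loc_rel R S"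
    for a s b t a' s' b' t'
  proof -
    from that obtain v w where *:
      "a \<in> carrier R" "a' \<in> carrier R" "b \<in> carrier R" "b' \<in> carrier R"
      "s \<in> S" "s' \<in> S" "t \<in> S" "t' \<in> S" "v \<in> S" "w \<in> S"
      "v \<otimes> (a \<otimes> s') = v \<otimes> (a' \<otimes> s)" "w \<otimes> (b \<otimes> t') = w \<otimes> (b' \<otimes> t)"
      unfolding loc_rel_def by auto
    note [simp] = *(1-10)
    have "(v \<otimes> w) \<otimes> ((a \<otimes> t \<oplus> b \<otimes> s) \<otimes> (s' \<otimes> t')) =
        (v \<otimes> (a \<otimes> s')) \<otimes> (w \<otimes> (t \<otimes> t')) \<oplus> (w \<otimes> (b \<otimes> t')) \<otimes> (v \<otimes> (s \<otimes> s'))"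
      by (simp add: r_distr l_distr m_ac)
    also have "\<dots> = (v \<otimes> w) \<otimes> ((a' \<otimes> t' \<oplus> b' \<otimes> s') \<otimes> (s \<otimes> t))"
      unfolding *(11,12) by (simp add: r_distr l_distr m_ac)
    finally show ?thesis
      using mult_S by (subst loc_frac_eq_iff) auto
  qed
  from loc_UN[where f = "\<lambda>a s b t. loc_frac R S (a \<otimes> t \<oplus> b \<otimes> s) (s \<otimes> t)", OF this assms]
  show ?thesis unfolding localization_def by simp
qed

lemma loc_one: "\<one>\<^bsub>localization R S\<^esub> = loc_frac R S \<one> \<one>"
  and loc_zero: "\<zero>\<^bsub>localization R S\<^esub> = loc_frac R S \<zero> \<one>"
  by (simp_all add: localization_def)

lemma loc_frac_eqI:
  assumes "a \<in> carrier R" "s \<in> S" "b \<in> carrier R" "t \<in> S" "a \<otimes> t = b \<otimes> s"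
  shows "loc_frac R S a s = loc_frac R S b t"
  using assms one_S by (subst loc_frac_eq_iff) auto

lemma cring_localization: "cring (localization R S)" (is "cring ?L")
proof (rule cringI)
  note [simp] = loc_add loc_mult loc_one loc_zero loc_frac_carrier one_S mult_S
  show "abelian_group ?L"
  proof (rule abelian_groupI)
    fix x assume "x \<in> carrier ?L"
    then obtain a s where *: "x = loc_frac R S a s" "a \<in> carrier R" "s \<in> S"
      by (rule loc_carrierE)
    show "\<exists>y\<in>carrier ?L. y \<oplus>\<^bsub>?L\<^esub> x = \<zero>\<^bsub>?L\<^esub>"
    proof (rule bexI[of _ "loc_frac R S (\<ominus> a) s"])
      have "loc_frac R S \<zero> (s \<otimes> s) = loc_frac R S \<zero> \<one>"
        using * by (intro loc_frac_eqI) simp_all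
      then show "loc_frac R S (\<ominus> a) s \<oplus>\<^bsub>?L\<^esub> x = \<zero>\<^bsub>?L\<^esub>"
        using * by (simp add: l_minus l_neg)
    qed (use * in simp)
    show "\<zero>\<^bsub>?L\<^esub> \<oplus>\<^bsub>?L\<^esub> x = x"
      using * by simp
    fix y assume "y \<in> carrier ?L"
    then obtain b t where **: "y = loc_frac R S b t" "b \<in> carrier R" "t \<in> S"
      by (rule loc_carrierE)
    show "x \<oplus>\<^bsub>?L\<^esub> y \<in> carrier ?L"
      using * ** by simp
    show "x \<oplus>\<^bsub>?L\<^esub> y = y \<oplus>\<^bsub>?L\<^esub> x"
      using * ** by (simp add: a_comm m_comm)
    fix z assume "z \<in> carrier ?L"
    then obtain c r where "z = loc_frac R S c r" "c \<in> carrier R" "r \<in> S"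
      by (rule loc_carrierE)
    with * ** show "x \<oplus>\<^bsub>?L\<^esub> y \<oplus>\<^bsub>?L\<^esub> z = x \<oplus>\<^bsub>?L\<^esub> (y \<oplus>\<^bsub>?L\<^esub> z)"
      by (simp add: l_distr r_distr m_ac a_ac)
  qed simp
  show "comm_monoid ?L"
  proof (rule comm_monoidI)
    fix x assume "x \<in> carrier ?L"
    then obtain a s where *: "x = loc_frac R S a s" "a \<in> carrier R" "s \<in> S"
      by (rule loc_carrierE)
    show "\<one>\<^bsub>?L\<^esub> \<otimes>\<^bsub>?L\<^esub> x = x"
      using * by simp
    fix y assume "y \<in> carrier ?L"
    then obtain b t where **: "y = loc_frac R S b t" "b \<in> carrier R" "t \<in> S"
      by (rule loc_carrierE)
    show "x \<otimes>\<^bsub>?L\<^esub> y \<in> carrier ?L"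
      using * ** by simp
    show "x \<otimes>\<^bsub>?L\<^esub> y = y \<otimes>\<^bsub>?L\<^esub> x"
      using * ** by (simp add: m_comm)
    fix z assume "z \<in> carrier ?L"
    then obtain c r where "z = loc_frac R S c r" "c \<in> carrier R" "r \<in> S"
      by (rule loc_carrierE)
    with * ** show "x \<otimes>\<^bsub>?L\<^esub> y \<otimes>\<^bsub>?L\<^esub> z = x \<otimes>\<^bsub>?L\<^esub> (y \<otimes>\<^bsub>?L\<^esub> z)"
      by (simp add: m_ac)
  qed simp
  fix x y z assume xyz: "x \<in> carrier ?L" "y \<in> carrier ?L" "z \<in> carrier ?L"
  obtain a s where *: "x = loc_frac R S a s" "a \<in> carrier R" "s \<in> S"
    using xyz(1) by (rule loc_carrierE)
  obtain b t where **: "y = loc_frac R S b t" "b \<in> carrier R" "t \<in> S"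
    using xyz(2) by (rule loc_carrierE)
  obtain c r where ***: "z = loc_frac R S c r" "c \<in> carrier R" "r \<in> S"
    using xyz(3) by (rule loc_carrierE)
  have "loc_frac R S ((a \<otimes> t \<oplus> b \<otimes> s) \<otimes> c) (s \<otimes> t \<otimes> r) =
     loc_frac R S ((a \<otimes> c) \<otimes> (t \<otimes> r) \<oplus> (b \<otimes> c) \<otimes> (s \<otimes> r)) ((s \<otimes> r) \<otimes> (t \<otimes> r))"
    using * ** *** by (intro loc_frac_eqI) (simp_all add: l_distr r_distr m_ac)
  then show "(x \<oplus>\<^bsub>?L\<^esub> y) \<otimes>\<^bsub>?L\<^esub> z = x \<otimes>\<^bsub>?L\<^esub> z \<oplus>\<^bsub>?L\<^esub> y \<otimes>\<^bsub>?L\<^esub> z"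
    using * ** *** by simp
qed

end


section \<open>The local ring of the diagonal hypersurface at the origin\<close>

text \<open>
  A polynomial maps each exponent vector to its coefficient; the index type \<open>4\<close> has
  exactly four elements.
\<close>

type_synonym 'k poly4 = "(4 \<Rightarrow>\<^sub>0 nat) \<Rightarrow>\<^sub>0 'k"

definition Var :: "4 \<Rightarrow> 'k::field poly4" where
  "Var i = Poly_Mapping.single (Poly_Mapping.single i 1) 1"

definition poly_ring4 :: "'k::field poly4 ring" where
  "poly_ring4 = ring_of_type_algebra"

definition hyp_ideal :: "'k::field poly4 set" where
  "hyp_ideal = Idl\<^bsub>poly_ring4\<^esub> {\<Sum>i\<in>UNIV. Var i ^ 7}"

definition hyp_ring :: "'k::field poly4 set ring" where
  "hyp_ring = poly_ring4 Quot hyp_ideal"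

definition hyp_var :: "4 \<Rightarrow> 'k::field poly4 set" where
  "hyp_var i = hyp_ideal +>\<^bsub>poly_ring4\<^esub> Var i"

definition hyp_max :: "'k::field poly4 set set" where
  "hyp_max = Idl\<^bsub>hyp_ring\<^esub> (range hyp_var)"

definition hyp_local :: "('k::field poly4 set \<times> 'k poly4 set) set ring" where
  "hyp_local = localization_at hyp_ring hyp_max"

text \<open>The image \<open>x\<^sub>i / 1\<close> of the \<open>i\<close>-th variable in the local ring.\<close>

definition local_var :: "4 \<Rightarrow> ('k::field poly4 set \<times> 'k poly4 set) set" where
  "local_var i = loc_frac hyp_ring (carrier hyp_ring - hyp_max) (hyp_var i) \<one>\<^bsub>hyp_ring\<^esub>"

end

theory Submission
  imports Defs
begin

text \<open>
  Write \<open>f = x\<^sub>1\<^sup>7 + x\<^sub>2\<^sup>7 + x\<^sub>3\<^sup>7 + x\<^sub>4\<^sup>7\<close>.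

  One inclusion is a colon computation. Since \<open>x\<^sub>i\<^sup>9 = x\<^sub>i\<^sup>2 x\<^sub>i\<^sup>7\<close>, the element \<open>x\<^sub>i\<^sup>3\<close> lies in the
  Frobenius closure of the ideal \<open>I\<^sub>i\<close> generated by the squares of the other variables, so the
  test ideal is contained in every \<open>I\<^sub>i : x\<^sub>i\<^sup>3\<close>. Their intersection is a monomial ideal, and it is
  generated by the \<open>x\<^sub>i\<^sup>2 x\<^sub>j\<^sup>2\<close>.

  For the other inclusion, let \<open>l\<close> be an additive map of \<open>k\<close> with \<open>l (a\<^sup>3 b) = a l b\<close>. Taking \<open>l\<close> of the
  coefficients whose exponents lie in a residue class \<open>r\<close> modulo 3 is an inverse-Frobenius linear
  map of the polynomial ring, and its composition \<open>\<phi>\<close> with multiplication by \<open>f\<^sup>2\<close> preserves the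
  multiples of \<open>f\<close>. If \<open>t u\<^sup>3\<^sup>q\<close> lies in \<open>I\<^bsup>[3q]\<^esup>\<close>, then \<open>\<phi> t u\<^sup>q\<close> lies in \<open>I\<^bsup>[q]\<^esup>\<close>; hence the \<open>t\<close> with
  \<open>t u\<^sup>q \<in> I\<^bsup>[q]\<^esup>\<close> for all large \<open>q\<close> form an ideal stable under all \<open>\<phi>\<close>. A stable ideal that is not
  contained in \<open>(f)\<close> contains every \<open>x\<^sub>i\<^sup>2 x\<^sub>j\<^sup>2\<close>: as \<open>7 \<equiv> 1\<close> modulo 3, each \<open>\<phi>\<close> sends a monomial to a
  multiple of a single monomial, and suitable residue classes first contract an arbitrary element to
  \<open>x\<^sub>1\<^sup>6\<close> plus terms of degree at most 6, then isolate a single monomial, and finally reach all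
  generators. Applied to the ideals \<open>(f) : b\<close>, the same fact shows that \<open>f\<close> is prime.
\<close>

text \<open>Over itself, the polynomial ring has its ideals as submodules: \<open>P.subspace\<close>
  says that a set is an ideal, and \<open>P.span\<close> is the ideal generated by a set.\<close>

interpretation P: Modules.module "(*) :: 'k::field poly4 \<Rightarrow> 'k poly4 \<Rightarrow> 'k poly4"
  by unfold_locales (simp_all add: algebra_simps)

text \<open>As a simplification rule \<open>scale_scale\<close> is associativity read backwards and loops with
  \<open>mult_ac\<close>.\<close>

declare P.scale_scale [simp del]

abbreviation pcoeff :: "'k::field poly4 \<Rightarrow> (4 \<Rightarrow>\<^sub>0 nat) \<Rightarrow> 'k" where
  "pcoeff \<equiv> Poly_Mapping.lookup"

abbreviation pmonom :: "(4 \<Rightarrow>\<^sub>0 nat) \<Rightarrow> 'k::field \<Rightarrow> 'k poly4" where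
  "pmonom \<equiv> Poly_Mapping.single"

subsection \<open>Exponent vectors\<close>

lemma UNIV_4: "(UNIV :: 4 set) = {0, 1, 2, 3}"
proof -
  have "card {0, 1, 2, 3 :: 4} = 4" by simp
  then show ?thesis by (metis card_subset_eq finite subset_UNIV card_num1 card_bit0 numeral_Bit0 mult_2 one_add_one mult.right_neutral)
qed

lemma forall_4: "(\<forall>i::4. P i) \<longleftrightarrow> P 0 \<and> P 1 \<and> P 2 \<and> P 3"
  using UNIV_4 by (metis UNIV_I insertE empty_iff)

type_synonym quad = "nat \<times> nat \<times> nat \<times> nat"

definition xp :: "quad \<Rightarrow> (4 \<Rightarrow>\<^sub>0 nat)" where
  "xp t = (case t of (a, b, c, d) \<Rightarrow>
     Poly_Mapping.single 0 a + Poly_Mapping.single 1 b +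
     Poly_Mapping.single 2 c + Poly_Mapping.single 3 d)"

lemma lookup_xp [simp]:
  "Poly_Mapping.lookup (xp (a, b, c, d)) 0 = a"
  "Poly_Mapping.lookup (xp (a, b, c, d)) 1 = b"
  "Poly_Mapping.lookup (xp (a, b, c, d)) 2 = c"
  "Poly_Mapping.lookup (xp (a, b, c, d)) 3 = d"
  by (simp_all add: xp_def lookup_add lookup_single)

lemma expo_eq_iff:
  "m = n \<longleftrightarrow> Poly_Mapping.lookup m 0 = Poly_Mapping.lookup n 0 \<and>
     Poly_Mapping.lookup m 1 = Poly_Mapping.lookup n 1 \<and>
     Poly_Mapping.lookup m 2 = Poly_Mapping.lookup n 2 \<and>
     Poly_Mapping.lookup m 3 = Poly_Mapping.lookup n (3::4)"
  unfolding poly_mapping_eq_iff fun_eq_iff forall_4 by simp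

lemma xp_eq_iff [simp]: "xp s = xp t \<longleftrightarrow> s = t"
  by (cases s, cases t) (simp add: expo_eq_iff)

lemma inj_xp: "inj xp"
  by (simp add: inj_def)

lemma xp_add: "xp (a, b, c, d) + xp (a', b', c', d') = xp (a + a', b + b', c + c', d + d')"
  by (simp add: expo_eq_iff lookup_add)

lemma xp_exists: "\<exists>t. m = xp t"
proof -
  have "m = xp (Poly_Mapping.lookup m 0, Poly_Mapping.lookup m 1, Poly_Mapping.lookup m 2, Poly_Mapping.lookup m 3)"
    by (simp add: expo_eq_iff)
  then show ?thesis by blast
qed

lemma xp_cases: obtains a b c d where "m = xp (a, b, c, d)"
  using xp_exists by (metis surj_pair)

text \<open>An entry of \<open>r\<close> is at most 2, so \<open>3n + r >= 3m\<close> forces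
  \<open>n >= m\<close> in each coordinate.\<close>

lemma expo_le_triple:
  fixes m n r k :: "4 \<Rightarrow>\<^sub>0 nat"
  assumes r: "\<forall>i. Poly_Mapping.lookup r i \<le> 2" and eq: "n + n + n + r = (m + m + m) + k"
  obtains n' where "n = m + n'" "k = n' + n' + n' + r"
proof -
  have *: "3 * Poly_Mapping.lookup n i + Poly_Mapping.lookup r i =
      3 * Poly_Mapping.lookup m i + Poly_Mapping.lookup k i" for i
    using arg_cong[OF eq, of "\<lambda>x. Poly_Mapping.lookup x i"] by (simp add: lookup_add)
  have le: "Poly_Mapping.lookup m i \<le> Poly_Mapping.lookup n i" for i
  proof -
    have "Poly_Mapping.lookup r i \<le> 2" using r by blast
    with *[of i] show ?thesis by linarith
  qed
  have "n = m + (n - m)"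
    using le by (intro poly_mapping_eqI) (simp add: lookup_add lookup_minus)
  moreover have "k = (n - m) + (n - m) + (n - m) + r"
  proof (rule poly_mapping_eqI)
    fix i show "Poly_Mapping.lookup k i = Poly_Mapping.lookup ((n - m) + (n - m) + (n - m) + r) i"
      using le[of i] *[of i] by (simp add: lookup_add lookup_minus)
  qed
  ultimately show ?thesis by (rule that)
qed

subsection \<open>Coefficients\<close>

lemma coeff_monom_mult: "pcoeff (pmonom m c * g) (m + k) = c * pcoeff g k"
proof -
  have "(\<Sum>q. pcoeff g q when m + k = m + q) = pcoeff g k"
    by (simp add: when_def[abs_def])
  moreover have "pcoeff (pmonom m c * g) (m + k) =
     (\<Sum>l. (c when m = l) * (\<Sum>q. pcoeff g q when m + k = l + q))"
    by (simp add: lookup_mult lookup_single)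
  ultimately show ?thesis
    by (simp add: when_mult)
qed

lemma coeff_monom_mult_0:
  assumes "\<And>k. n \<noteq> m + k"
  shows "pcoeff (pmonom m c * g) n = 0"
proof -
  have "pcoeff (pmonom m c * g) n = (\<Sum>l. (c when m = l) * (\<Sum>q. pcoeff g q when n = l + q))"
    by (simp add: lookup_mult lookup_single)
  also have "\<dots> = c * (\<Sum>q. pcoeff g q when n = m + q)"
    by (simp add: when_mult)
  finally show ?thesis using assms by simp
qed

lemma poly4_induct [case_names pmonom add]:
  fixes g :: "'k::field poly4"
  assumes pmonom: "\<And>m c. P (pmonom m c)" and add: "\<And>g h. P g \<Longrightarrow> P h \<Longrightarrow> P (g + h)"
  shows "P g"
proof (induction g rule: update_induct)
  case const
  from pmonom[of 0 0] show ?case by simp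
next
  case (update g a b)
  have "Poly_Mapping.update a b g = pmonom a b + g"
    using update(1) by (intro poly_mapping_eqI)
      (auto simp: lookup_update lookup_add lookup_single when_def in_keys_iff)
  with add pmonom update show ?case by simp
qed

lemma Var_power: "(Var i :: 'k::field poly4) ^ n = pmonom (Poly_Mapping.single i n) 1"
  by (induction n) (simp_all add: Var_def mult_single single_add[symmetric])

subsection \<open>Cube roots\<close>

definition semilin :: "('k::field \<Rightarrow> 'k) \<Rightarrow> bool" where
  "semilin l \<longleftrightarrow> (\<forall>a b. l (a + b) = l a + l b) \<and> (\<forall>a b. l (a ^ 3 * b) = a * l b)"

lemma semilin_0: "semilin l \<Longrightarrow> l 0 = 0"
  unfolding semilin_def by (metis add_cancel_right_right)

lemma cube_add:
  assumes "(3::'a::comm_ring_1) = 0"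
  shows "(a + b) ^ 3 = a ^ 3 + (b::'a) ^ 3"
proof -
  have "(a + b) ^ 3 = a ^ 3 + b ^ 3 + 3 * (a ^ 2 * b + a * b ^ 2)"
    by (simp add: algebra_simps power3_eq_cube power2_eq_square)
  with assms show ?thesis by simp
qed

text \<open>With scalars acting through their cubes, \<open>'k\<close> is a vector space over itself
  in which a nonzero \<open>c\<close> is independent. The value 1 at \<open>c\<close> therefore
  extends linearly, for imperfect fields as well.\<close>

lemma semilin_exists:
  fixes c :: "'k::field"
  assumes "(3::'k) = 0" "c \<noteq> 0"
  shows "\<exists>l. semilin l \<and> l c = 1"
proof -
  interpret V: Vector_Spaces.vector_space "\<lambda>a b::'k. a ^ 3 * b"
    by unfold_locales (simp_all add: algebra_simps cube_add[OF assms(1)] power_mult_distrib)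
  interpret W: Vector_Spaces.vector_space "\<lambda>a b::'k. a * b"
    by unfold_locales (simp_all add: algebra_simps)
  interpret VW: Vector_Spaces.vector_space_pair "\<lambda>a b::'k. a ^ 3 * b" "\<lambda>a b::'k. a * b"
    by unfold_locales
  have "V.independent {c}"
    using assms(2) by simp
  from VW.linear_independent_extend[OF this, of "\<lambda>_. 1"]
  obtain g where g: "Vector_Spaces.linear (\<lambda>a b. a ^ 3 * b) (\<lambda>a b. a * b) g" "g c = 1"
    by auto
  have "semilin g"
    using g(1) unfolding semilin_def
    by (metis Vector_Spaces.linear_iff)
  with g show ?thesis by blast
qed

text \<open>For perfect \<open>'k\<close> and \<open>l\<close> the cube root, this is the coordinate
  at the monomial \<open>x^r\<close> in the monomial basis over the subring of cubes, followed by
  the inverse of Frobenius.\<close>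

definition ctr :: "('k::field \<Rightarrow> 'k) \<Rightarrow> (4 \<Rightarrow>\<^sub>0 nat) \<Rightarrow> 'k poly4 \<Rightarrow> 'k poly4" where
  "ctr l r g = Poly_Mapping.map l (Poly_Mapping.map_key (\<lambda>n. n + n + n + r) g)"

lemma inj_triple: "inj (\<lambda>n::4 \<Rightarrow>\<^sub>0 nat. n + n + n + r)"
proof (rule injI)
  fix m n :: "4 \<Rightarrow>\<^sub>0 nat" assume "m + m + m + r = n + n + n + r"
  then have "Poly_Mapping.lookup (m + m + m + r) i = Poly_Mapping.lookup (n + n + n + r) i" for i
    by simp
  then have "Poly_Mapping.lookup m i = Poly_Mapping.lookup n i" for i
    unfolding lookup_add by (metis add_right_cancel mult_2 mult_cancel_left numeral_3_eq_3 mult_Suc add.commute nat.simps(3) numeral_2_eq_2 )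
  then show "m = n" by (rule poly_mapping_eqI)
qed

lemma coeff_ctr:
  assumes "semilin l"
  shows "pcoeff (ctr l r g) n = l (pcoeff g (n + n + n + r))"
  using semilin_0[OF assms] unfolding ctr_def
  by (simp add: map.rep_eq map_key.rep_eq[OF inj_triple] when_def)

lemma ctr_add: "semilin l \<Longrightarrow> ctr l r (g + h) = ctr l r g + ctr l r h"
  by (rule poly_mapping_eqI) (simp add: coeff_ctr lookup_add semilin_def)

lemma char3_poly4: "CHAR('k::field) = 3 \<Longrightarrow> (3 :: 'k poly4) = 0"
proof -
  assume "CHAR('k) = 3"
  then have "of_nat 3 = (0::'k)" by (metis of_nat_CHAR)
  then have "(3::'k) = 0" by simp
  then show ?thesis by (metis single_numeral single_zero)
qed

text \<open>Cubing is additive in characteristic 3, so a monomial \<open>w\<close> of exponent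
  \<open>m\<close> suffices; there \<open>3n + r\<close> has the form \<open>3m + k\<close> exactly
  when \<open>n >= m\<close>.\<close>

lemma ctr_cube_mult:
  fixes w g :: "'k::field poly4"
  assumes l: "semilin l" and r: "\<forall>i. Poly_Mapping.lookup r i \<le> 2" and ch: "CHAR('k) = 3"
  shows "ctr l r (w ^ 3 * g) = w * ctr l r g"
proof (induction w rule: poly4_induct)
  case (pmonom m c)
  have eq: "pmonom m c ^ 3 = pmonom (m + m + m) (c ^ 3)"
    by (simp add: power3_eq_cube mult_single)
  show ?case unfolding eq
  proof (rule poly_mapping_eqI)
    fix n
    show "pcoeff (ctr l r (pmonom (m + m + m) (c ^ 3) * g)) n = pcoeff (pmonom m c * ctr l r g) n"
    proof (cases "\<exists>k. n + n + n + r = (m + m + m) + k")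
      case True
      then obtain n' where "n = m + n'"
        using expo_le_triple[OF r] by metis
      moreover from this have "n + n + n + r = (m + m + m) + (n' + n' + n' + r)"
        by (simp add: algebra_simps)
      ultimately show ?thesis
        using l by (simp add: coeff_ctr coeff_monom_mult semilin_def)
    next
      case False
      have "n \<noteq> m + k" for k
      proof
        assume "n = m + k"
        then have "n + n + n + r = (m + m + m) + (k + k + k + r)"
          by (simp add: algebra_simps)
        with False show False by blast
      qed
      with False show ?thesis
        using semilin_0[OF l] by (simp add: coeff_ctr[OF l] coeff_monom_mult_0)
    qed
  qed
next
  case (add g' h')
  then show ?case
    by (simp add: cube_add[OF char3_poly4[OF ch]] distrib_right ctr_add[OF l])
qed

section \<open>The hypersurface equation and its trace maps\<close>

abbreviation E :: "4 \<Rightarrow> (4 \<Rightarrow>\<^sub>0 nat)" where "E i \<equiv> Poly_Mapping.single i 7"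

definition hypf :: "'k::field poly4" where "hypf = (\<Sum>i\<in>UNIV. Var i ^ 7)"

lemma hypf_eq: "hypf = (\<Sum>i\<in>UNIV. pmonom (E i) 1)"
  by (simp add: hypf_def Var_power)

lemma hypf_sq_mult: "hypf ^ 2 * g = (\<Sum>(i, j)\<in>UNIV. pmonom (E i + E j) 1 * g)"
  unfolding UNIV_Times_UNIV[symmetric] sum.cartesian_product[symmetric]
proof -
  have "hypf ^ 2 = (\<Sum>i\<in>UNIV. \<Sum>j\<in>UNIV. pmonom (E i + E j) (1::'a))"
    unfolding hypf_eq power2_eq_square sum_product by (simp add: mult_single)
  then show "hypf ^ 2 * g = (\<Sum>i\<in>UNIV. \<Sum>j\<in>UNIV. pmonom (E i + E j) 1 * g)"
    by (simp add: sum_distrib_right)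
qed

text \<open>Source and target are kept apart because the maps lower the threshold exponent of
  \<open>multipliers\<close> by one.\<close>

definition trace_maps :: "'k::field poly4 set \<Rightarrow> 'k poly4 set \<Rightarrow> bool" where
  "trace_maps T T' \<longleftrightarrow>
     (\<forall>l r g. semilin l \<longrightarrow> (\<forall>i. Poly_Mapping.lookup r i \<le> 2) \<longrightarrow> g \<in> T \<longrightarrow> ctr l r (hypf ^ 2 * g) \<in> T')"

definition stable :: "'k::field poly4 set \<Rightarrow> bool" where
  "stable T \<longleftrightarrow> P.subspace T \<and> hypf \<in> T \<and> trace_maps T T"

lemma stable_trace_maps: "stable T \<Longrightarrow> trace_maps T T"
  by (simp add: stable_def)

lemma E_add_eq_iff: "E i' + E j' = E i + E j \<longleftrightarrow> (i' = i \<and> j' = j) \<or> (i' = j \<and> j' = i)"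
proof
  assume "E i' + E j' = E i + E j"
  then have *: "Poly_Mapping.lookup (E i' + E j') k = Poly_Mapping.lookup (E i + E j) k" for k by simp
  show "(i' = i \<and> j' = j) \<or> (i' = j \<and> j' = i)"
    using *[of i] *[of j] by (auto simp: lookup_add lookup_single when_def split: if_splits)
qed (auto simp: add.commute)

text \<open>By \<open>uniq\<close>, only the term of \<open>g\<close> at \<open>m\<close>
  contributes to the coefficient of \<open>hypf ^ 2 * g\<close> at \<open>3n + r\<close>, so nothing
  cancels it; \<open>l\<close> is then chosen to send this coefficient to 1.\<close>

lemma trace_maps_extract:
  fixes T :: "'k::field poly4 set"
  assumes st: "trace_maps T T'" and ch: "CHAR('k) = 3" and g: "g \<in> T"
    and r: "\<forall>i. Poly_Mapping.lookup r i \<le> 2"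
    and m: "m \<in> Poly_Mapping.keys g" and eq: "n + n + n + r = E i + E j + m"
    and uniq: "\<And>i' j' m'. m' \<in> Poly_Mapping.keys g \<Longrightarrow> n + n + n + r = E i' + E j' + m' \<Longrightarrow> m' = m"
  shows "\<exists>h\<in>T'. n \<in> Poly_Mapping.keys h \<and>
    Poly_Mapping.keys h \<subseteq> {n'. \<exists>i' j'. \<exists>m'\<in>Poly_Mapping.keys g. n' + n' + n' + r = E i' + E j' + m'}"
proof -
  let ?N = "n + n + n + r"
  let ?A = "{(i', j'). E i' + E j' = E i + E j}"
  have "pcoeff (pmonom (E i' + E j') 1 * g) ?N = (if (i', j') \<in> ?A then pcoeff g m else 0)" for i' j'
  proof (cases "(i', j') \<in> ?A")
    case True
    then show ?thesis using coeff_monom_mult[of "E i' + E j'" 1 g m] eq by simp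
  next
    case False
    show ?thesis
    proof (cases "\<exists>k. ?N = E i' + E j' + k")
      case True
      then obtain k where k: "?N = E i' + E j' + k" by blast
      have "pcoeff g k = 0"
      proof (rule ccontr)
        assume "pcoeff g k \<noteq> 0"
        then have "k = m" using uniq k by (auto simp: in_keys_iff)
        with k eq have "E i' + E j' = E i + E j" by (metis add_right_cancel)
        with False show False by simp
      qed
      with k False show ?thesis by (metis coeff_monom_mult mult_zero_right)
    next
      case F: False
      with False show ?thesis by (subst coeff_monom_mult_0) auto
    qed
  qed
  then have "pcoeff (hypf ^ 2 * g) ?N = (\<Sum>x\<in>UNIV. if x \<in> ?A then pcoeff g m else 0)"
    unfolding hypf_sq_mult lookup_sum by (intro sum.cong) auto
  also have "\<dots> = of_nat (card ?A) * pcoeff g m"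
    by (simp add: sum.If_cases)
  finally have cN: "pcoeff (hypf ^ 2 * g) ?N = of_nat (card ?A) * pcoeff g m" .
  \<comment> \<open>The coefficients of \<open>hypf ^ 2\<close> are 1 and 2, both nonzero in
    characteristic 3.\<close>
  have "?A = {(i, j), (j, i)}" using E_add_eq_iff by auto
  then have "card ?A = 1 \<or> card ?A = 2" by (cases "i = j") auto
  then have "(of_nat (card ?A) :: 'k) \<noteq> 0"
    using ch by (auto simp: of_nat_eq_0_iff_char_dvd simp del: of_nat_numeral of_nat_1)
  with cN m have ne: "pcoeff (hypf ^ 2 * g) ?N \<noteq> 0" by (simp add: in_keys_iff)
  have three: "(3::'k) = 0" using ch by (metis of_nat_CHAR of_nat_numeral)
  obtain l where l: "semilin l" "l (pcoeff (hypf ^ 2 * g) ?N) = 1"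
    using semilin_exists[OF three ne] by blast
  let ?h = "ctr l r (hypf ^ 2 * g)"
  have "?h \<in> T'" using st l r g unfolding trace_maps_def by blast
  moreover have "n \<in> Poly_Mapping.keys ?h" using l by (simp add: in_keys_iff coeff_ctr)
  moreover have "\<exists>i' j'. \<exists>m'\<in>Poly_Mapping.keys g. n' + n' + n' + r = E i' + E j' + m'"
    if "n' \<in> Poly_Mapping.keys ?h" for n'
  proof -
    have "pcoeff (hypf ^ 2 * g) (n' + n' + n' + r) \<noteq> 0"
      using that semilin_0[OF l(1)] by (auto simp: in_keys_iff coeff_ctr[OF l(1)])
    then obtain x where "(case x of (i', j') \<Rightarrow> pcoeff (pmonom (E i' + E j') 1 * g) (n' + n' + n' + r)) \<noteq> 0"
      unfolding hypf_sq_mult lookup_sum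
      by (metis (mono_tags, lifting) sum.neutral split_def)
    then obtain i' j' where x: "pcoeff (pmonom (E i' + E j') 1 * g) (n' + n' + n' + r) \<noteq> 0"
      by (cases x) auto
    then obtain k where k: "n' + n' + n' + r = E i' + E j' + k"
      using coeff_monom_mult_0 by metis
    with x have "k \<in> Poly_Mapping.keys g" by (simp add: coeff_monom_mult in_keys_iff)
    with k show ?thesis by blast
  qed
  ultimately show ?thesis by blast
qed

section \<open>Combinatorics of the supports\<close>

text \<open>The monomials of \<open>f\<^sup>2\<close> are the \<open>x\<^bsup>7a\<^esup>\<close> with \<open>a\<close> in \<open>digits\<close>; in the next definition, \<open>n\<close> is
  an exponent that \<open>\<phi>\<close> with residue class \<open>r\<close> can produce from the exponent \<open>m\<close>.\<close>

definition digits :: "quad list" where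
  "digits = [(2,0,0,0), (0,2,0,0), (0,0,2,0), (0,0,0,2), (1,1,0,0), (1,0,1,0), (1,0,0,1),
     (0,1,1,0), (0,1,0,1), (0,0,1,1)]"

fun hit :: "quad \<Rightarrow> quad \<Rightarrow> quad \<Rightarrow> bool" where
  "hit (r1, r2, r3, r4) (m1, m2, m3, m4) (n1, n2, n3, n4) \<longleftrightarrow>
     (\<exists>(a1, a2, a3, a4)\<in>set digits. 3 * n1 + r1 = 7 * a1 + m1 \<and> 3 * n2 + r2 = 7 * a2 + m2 \<and>
        3 * n3 + r3 = 7 * a3 + m3 \<and> 3 * n4 + r4 = 7 * a4 + m4)"

lemma ex_4: "(\<exists>i::4. P i) \<longleftrightarrow> P 0 \<or> P 1 \<or> P 2 \<or> P 3"
  using forall_4[of "\<lambda>i. \<not> P i"] by blast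

lemma hit_iff: "hit r m n \<longleftrightarrow> (\<exists>i j. xp n + xp n + xp n + xp r = E i + E j + xp m)"
proof -
  have E: "E 0 = xp (7,0,0,0)" "E 1 = xp (0,7,0,0)" "E 2 = xp (0,0,7,0)" "E 3 = xp (0,0,0,7)"
    by (simp_all add: expo_eq_iff lookup_single del: single_numeral)
  obtain r1 r2 r3 r4 m1 m2 m3 m4 n1 n2 n3 n4 where
    "r = (r1, r2, r3, r4)" "m = (m1, m2, m3, m4)" "n = (n1, n2, n3, n4)"
    by (metis surj_pair)
  moreover have triple: "x + x + x + y = 3 * x + y" for x y :: nat by simp
  ultimately show ?thesis
    unfolding ex_4 by (simp add: digits_def E xp_add triple del: single_numeral) (rule iffI; elim disjE; simp)
qed

text \<open>Only supports are recorded, which turns the contraction into a question about exponents: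
  \<open>M\<close> bounds the support and \<open>m\<close> certainly occurs.\<close>

definition achieves :: "'k::field poly4 set \<Rightarrow> quad set \<Rightarrow> quad \<Rightarrow> bool" where
  "achieves T M m \<longleftrightarrow> (\<exists>g\<in>T. xp m \<in> Poly_Mapping.keys g \<and> Poly_Mapping.keys g \<subseteq> xp ` M)"

lemma achieves_mono: "achieves T M m \<Longrightarrow> M \<subseteq> N \<Longrightarrow> achieves T N m"
  unfolding achieves_def by blast

lemma achieves_mem: "achieves T M m \<Longrightarrow> m \<in> M"
  unfolding achieves_def using inj_xp by (auto simp: inj_def)

fun small :: "quad \<Rightarrow> bool" where "small (a, b, c, d) \<longleftrightarrow> a \<le> 2 \<and> b \<le> 2 \<and> c \<le> 2 \<and> d \<le> 2"

lemma small_xp: "small r \<Longrightarrow> \<forall>i. Poly_Mapping.lookup (xp r) i \<le> 2"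
  by (cases r) (simp add: forall_4)

text \<open>\<open>uniq\<close> excludes cancellation at \<open>n\<close>; about all other exponents
  only the possibility of being hit is kept.\<close>

lemma achieves_step:
  fixes T :: "'k::field poly4 set"
  assumes "trace_maps T T'" "CHAR('k) = 3" and A: "achieves T M m" and "small r" "hit r m n"
    and uniq: "\<And>m'. m' \<in> M \<Longrightarrow> hit r m' n \<Longrightarrow> m' = m"
  shows "achieves T' {n'. \<exists>m'\<in>M. hit r m' n'} n"
proof -
  obtain g where g: "g \<in> T" "xp m \<in> Poly_Mapping.keys g" "Poly_Mapping.keys g \<subseteq> xp ` M"
    using A unfolding achieves_def by blast
  obtain i j where ij: "xp n + xp n + xp n + xp r = E i + E j + xp m"
    using assms(5) unfolding hit_iff by blast
  have u: "m' = xp m" if m': "m' \<in> Poly_Mapping.keys g" "xp n + xp n + xp n + xp r = E i' + E j' + m'" for i' j' m'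
  proof -
    obtain s where "m' = xp s" "s \<in> M" using m' g by blast
    with m' uniq[of s] show ?thesis unfolding hit_iff by blast
  qed
  have "\<exists>h\<in>T'. xp n \<in> Poly_Mapping.keys h \<and> Poly_Mapping.keys h \<subseteq>
      {n'. \<exists>i' j'. \<exists>m'\<in>Poly_Mapping.keys g. n' + n' + n' + xp r = E i' + E j' + m'}"
    using u by (intro trace_maps_extract[OF assms(1,2) g(1) small_xp[OF \<open>small r\<close>] g(2) ij])
  then obtain h where h: "h \<in> T'" "xp n \<in> Poly_Mapping.keys h" and
    k: "Poly_Mapping.keys h \<subseteq> {n'. \<exists>i' j'. \<exists>m'\<in>Poly_Mapping.keys g. n' + n' + n' + xp r = E i' + E j' + m'}"
    by blast
  have "Poly_Mapping.keys h \<subseteq> xp ` {n'. \<exists>m'\<in>M. hit r m' n'}"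
  proof
    fix x assume x: "x \<in> Poly_Mapping.keys h"
    obtain t where t: "x = xp t" using xp_exists by blast
    from x k obtain i' j' m' where m': "m' \<in> Poly_Mapping.keys g" "x + x + x + xp r = E i' + E j' + m'" by blast
    then obtain s where "m' = xp s" "s \<in> M" using g by blast
    with m' t show "x \<in> xp ` {n'. \<exists>m'\<in>M. hit r m' n'}" unfolding hit_iff by blast
  qed
  with h show ?thesis unfolding achieves_def by blast
qed

subsection \<open>Contracting an arbitrary element\<close>

definition box :: "nat \<Rightarrow> nat \<Rightarrow> quad set" where
  "box x D = {(a, b, c, d). a \<le> x \<and> a + b + c + d \<le> D}"

lemma hit_bounds:
  assumes "hit (r1, r2, r3, r4) (m1, m2, m3, m4) (n1, n2, n3, n4)"
  shows "3 * n1 + r1 \<le> 14 + m1" "3 * (n1 + n2 + n3 + n4) + r1 \<le> 14 + (m1 + m2 + m3 + m4)"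
  using assms by (auto simp: digits_def)

text \<open>Multiplying by \<open>x\<^sub>1\<^sup>1\<^sup>4\<close>, the part of \<open>f\<^sup>2\<close> of largest degree in \<open>x\<^sub>1\<close>, rules out collisions for an
  exponent that is maximal in the first coordinate.\<close>

lemma achieves_box_step:
  fixes T :: "'k::field poly4 set"
  assumes "stable T" "CHAR('k) = 3" "achieves T (box a D) (a, b, c, d)"
  shows "achieves T (box ((14 + a) div 3) ((14 + D - (14 + a) mod 3) div 3))
    ((14 + a) div 3, b div 3, c div 3, d div 3)"
proof -
  let ?r = "((14 + a) mod 3, b mod 3, c mod 3, d mod 3)"
  let ?n = "((14 + a) div 3, b div 3, c div 3, d div 3)"
  have dm: "3 * (x div 3) + x mod 3 = x" for x :: nat by simp
  have "small ?r" by simp linarith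
  moreover have "hit ?r (a, b, c, d) ?n"
    by (simp add: digits_def dm del: mult_div_mod_eq)
  \<comment> \<open>Any other entry of \<open>digits\<close> has first digit below 2 and would need
    a first coordinate above \<open>a\<close>.\<close>
  moreover have "m' = (a, b, c, d)" if "m' \<in> box a D" "hit ?r m' ?n" for m'
  proof (cases m')
    case (fields a' b' c' d')
    from that show ?thesis unfolding fields box_def hit.simps dm
      by (auto simp: digits_def)
  qed
  ultimately have "achieves T {n'. \<exists>m'\<in>box a D. hit ?r m' n'} ?n"
    by (intro achieves_step[OF stable_trace_maps[OF assms(1)] assms(2,3)])
  moreover have "{n'. \<exists>m'\<in>box a D. hit ?r m' n'} \<subseteq> box ((14 + a) div 3) ((14 + D - (14 + a) mod 3) div 3)"
  proof clarify
    fix n1 n2 n3 n4 m1 m2 m3 m4 assume m: "(m1, m2, m3, m4) \<in> box a D"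
      and h: "hit ?r (m1, m2, m3, m4) (n1, n2, n3, n4)"
    have "m1 \<le> a" "m1 + m2 + m3 + m4 \<le> D" using m by (auto simp: box_def)
    with hit_bounds[OF h] have "3 * n1 + (14 + a) mod 3 \<le> 14 + a"
      "3 * (n1 + n2 + n3 + n4) + (14 + a) mod 3 \<le> 14 + D" by (meson add_left_mono order_trans)+
    then have "n1 \<le> (14 + a) div 3" "n1 + n2 + n3 + n4 \<le> (14 + D - (14 + a) mod 3) div 3"
      by (auto simp: less_eq_div_iff_mult_less_eq)
    then show "(n1, n2, n3, n4) \<in> box ((14 + a) div 3) ((14 + D - (14 + a) mod 3) div 3)"
      by (simp add: box_def)
  qed
  ultimately show ?thesis by (rule achieves_mono)
qed

lemma box_mono: "D \<le> D' \<Longrightarrow> box a D \<subseteq> box a D'"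
  by (auto simp: box_def)

text \<open>The degree bound drops to at most \<open>(14 + D) div 3\<close>, which is less than
  \<open>D\<close> as long as \<open>D > 7\<close>; the bound 6 on \<open>a\<close> persists because
  \<open>(14 + 6) div 3 = 6\<close>.\<close>

lemma achieves_box_7:
  fixes T :: "'k::field poly4 set"
  assumes "stable T" "CHAR('k) = 3" "achieves T (box a D) (a, b, c, d)" "a \<le> 6"
  shows "\<exists>a b c d. a \<le> 6 \<and> achieves T (box a 7) (a, b, c, d)"
  using assms(3,4)
proof (induction D arbitrary: a b c d rule: less_induct)
  case (less D)
  show ?case
  proof (cases "D \<le> 7")
    case True
    with less.prems show ?thesis by (meson achieves_mono box_mono)
  next
    case False
    have "(14 + D - (14 + a) mod 3) div 3 < D" "(14 + a) div 3 \<le> 6"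
      using False less.prems by linarith+
    from less.IH[OF this(1) achieves_box_step[OF assms(1,2) less.prems(1)] this(2)]
    show ?thesis .
  qed
qed

text \<open>Two further steps bring the first coordinate to its fixed point 6, and two divisions by
  3 bring the others, at most 7, to 0.\<close>

lemma achieves_box_6:
  fixes T :: "'k::field poly4 set"
  assumes "stable T" "CHAR('k) = 3" "achieves T (box a D) (a, b, c, d)" "a \<le> 6"
  shows "achieves T (box 6 6) (6, 0, 0, 0)"
proof -
  note step = achieves_box_step[OF assms(1,2)]
  obtain a b c d where 1: "a \<le> 6" "achieves T (box a 7) (a, b, c, d)"
    using achieves_box_7[OF assms] by blast
  then have bcd: "b \<le> 7" "c \<le> 7" "d \<le> 7" using achieves_mem[OF 1(2)] by (auto simp: box_def)
  let ?a = "(14 + a) div 3"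
  from step[OF 1(2)] have 2: "achieves T (box ?a 7) (?a, b div 3, c div 3, d div 3)"
    by (rule achieves_mono) (intro box_mono, linarith)
  have "achieves T (box ((14 + ?a) div 3) 7) ((14 + ?a) div 3, b div 3 div 3, c div 3 div 3, d div 3 div 3)"
    using step[OF 2] by (rule achieves_mono) (intro box_mono, linarith)
  moreover have "(14 + ?a) div 3 = 6" "b div 3 div 3 = 0" "c div 3 div 3 = 0" "d div 3 div 3 = 0"
    using 1(1) bcd by linarith+
  ultimately have "achieves T (box 6 7) (6, 0, 0, 0)" by simp
  \<comment> \<open>The degree bound 7 falls only now: for \<open>a = 6\<close> the remainder is
    \<open>20 mod 3 = 2\<close>, and \<open>(14 + 7 - 2) div 3 = 6\<close>.\<close>
  from step[OF this] show ?thesis by simp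
qed

subsection \<open>Isolating a monomial\<close>

text \<open>The residue classes \<open>(0, 0, 0, 2)\<close>, \<open>(2, 0, 2, 1)\<close>, \<open>(0, 2, 1, 1)\<close> were found by a computer search
  over the exponents in \<open>box 6 6\<close>: the exponent \<open>(6, 0, 0, 0)\<close> travels through \<open>(2, 0, 0, 4)\<close> and
  \<open>(0, 0, 4, 1)\<close> to \<open>(0, 4, 1, 0)\<close>, and after the third step nothing else survives.\<close>

definition survivors1 :: "quad set" where
  "survivors1 = {(a, b, c, d). a + b + c + d \<le> 6 \<and> (5 \<le> a \<or> 5 \<le> b \<or> 5 \<le> c \<or> 4 \<le> d \<or>
     3 \<le> a \<and> 3 \<le> b \<or> 3 \<le> a \<and> 3 \<le> c \<or> 3 \<le> a \<and> 2 \<le> d \<or>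
     3 \<le> b \<and> 3 \<le> c \<or> 3 \<le> b \<and> 2 \<le> d \<or> 3 \<le> c \<and> 2 \<le> d)}"

definition survivors2 :: "quad set" where
  "survivors2 = {(0, 0, 4, 1), (1, 0, 2, 2), (1, 0, 4, 0), (2, 0, 1, 2), (2, 0, 2, 1), (4, 0, 0, 1), (4, 0, 1, 0)}"

lemma hitE:
  assumes "hit (r1, r2, r3, r4) (m1, m2, m3, m4) (n1, n2, n3, n4)"
  obtains a1 a2 a3 a4 where "(a1, a2, a3, a4) \<in> set digits" "3 * n1 + r1 = 7 * a1 + m1"
    "3 * n2 + r2 = 7 * a2 + m2" "3 * n3 + r3 = 7 * a3 + m3" "3 * n4 + r4 = 7 * a4 + m4"
  using assms by auto

lemma sum_digits: "(a1, a2, a3, a4) \<in> set digits \<Longrightarrow> a1 + a2 + a3 + a4 = 2"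
  by (auto simp: digits_def)

text \<open>The ten alternatives in \<open>survivors1\<close> match the ten \<open>digits\<close>:
  digit 2 forces a coordinate of at least 5 and digit 1 one of at least 3, or 4 and 2 in the last
  coordinate, whose residue is 2.\<close>

lemma hit_survivors1:
  assumes "m \<in> box 6 6" "hit (0, 0, 0, 2) m n"
  shows "n \<in> survivors1"
proof -
  obtain m1 m2 m3 m4 n1 n2 n3 n4 where e: "m = (m1, m2, m3, m4)" "n = (n1, n2, n3, n4)"
    by (metis surj_pair)
  have m: "m1 + m2 + m3 + m4 \<le> 6" using assms(1) by (simp add: box_def e)
  from assms(2)[unfolded e] obtain a1 a2 a3 a4 where a: "(a1, a2, a3, a4) \<in> set digits"
    "3 * n1 + 0 = 7 * a1 + m1" "3 * n2 + 0 = 7 * a2 + m2" "3 * n3 + 0 = 7 * a3 + m3" "3 * n4 + 2 = 7 * a4 + m4"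
    by (rule hitE)
  have "(3 * n1 + 0) + (3 * n2 + 0) + (3 * n3 + 0) + (3 * n4 + 2) =
      (7 * a1 + m1) + (7 * a2 + m2) + (7 * a3 + m3) + (7 * a4 + m4)"
    by (simp only: a(2-5))
  then have "3 * (n1 + n2 + n3 + n4) + 2 = 7 * (a1 + a2 + a3 + a4) + (m1 + m2 + m3 + m4)"
    by (simp add: algebra_simps)
  then have "3 * (n1 + n2 + n3 + n4) \<le> 18" using m sum_digits[OF a(1)] by simp
  then have s: "n1 + n2 + n3 + n4 \<le> 6" by simp
  have "(a = 2 \<longrightarrow> 5 \<le> x) \<and> (a = 1 \<longrightarrow> 3 \<le> x)" if "3 * x + 0 = 7 * a + y" for x y a :: nat
    using that by presburger
  note b = this[OF a(2)] this[OF a(3)] this[OF a(4)]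
  have b': "(a4 = 2 \<longrightarrow> 4 \<le> n4) \<and> (a4 = 1 \<longrightarrow> 2 \<le> n4)"
    using a(5) by presburger
  have "a1 = 2 \<or> a2 = 2 \<or> a3 = 2 \<or> a4 = 2 \<or> a1 = 1 \<and> a2 = 1 \<or> a1 = 1 \<and> a3 = 1 \<or> a1 = 1 \<and> a4 = 1 \<or>
      a2 = 1 \<and> a3 = 1 \<or> a2 = 1 \<and> a4 = 1 \<or> a3 = 1 \<and> a4 = 1"
    using a(1) by (auto simp: digits_def)
  with b b' s show ?thesis
    unfolding e survivors1_def by blast
qed

text \<open>Lower bounds of sum at least 4 together with degree at most 5 leave room for at most one
  extra unit, hence five candidates.\<close>

lemma candidates:
  fixes n1 n2 n3 n4 :: nat
  assumes "l1 \<le> n1" "l2 \<le> n2" "l3 \<le> n3" "l4 \<le> n4" "n1 + n2 + n3 + n4 \<le> 5" "4 \<le> l1 + l2 + l3 + l4"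
  obtains t1 t2 t3 t4 where "n1 = l1 + t1" "n2 = l2 + t2" "n3 = l3 + t3" "n4 = l4 + t4"
    "(t1, t2, t3, t4) \<in> {(0,0,0,0), (1,0,0,0), (0,1,0,0), (0,0,1,0), (0,0,0,1)}"
proof -
  obtain t1 t2 t3 t4 where t: "n1 = l1 + t1" "n2 = l2 + t2" "n3 = l3 + t3" "n4 = l4 + t4"
    using assms(1-4) by (auto simp: le_iff_add)
  then have "t1 + t2 + t3 + t4 \<le> 1" using assms(5,6) by simp
  then have "(t1, t2, t3, t4) \<in> {(0,0,0,0), (1,0,0,0), (0,1,0,0), (0,0,1,0), (0,0,0,1)}"
    by (cases t1; cases t2; cases t3; cases t4; simp)
  with t show ?thesis by (rule that)
qed

text \<open>Each of the ten digit vectors leaves five candidates for \<open>n\<close>; since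
  \<open>n\<close> and the digits determine \<open>m\<close>, the claim becomes a check of fifty
  cases.\<close>

lemma hit_survivors2:
  assumes "m \<in> survivors1" "hit (2, 0, 2, 1) m n"
  shows "n \<in> survivors2"
proof -
  obtain m1 m2 m3 m4 n1 n2 n3 n4 where e: "m = (m1, m2, m3, m4)" "n = (n1, n2, n3, n4)"
    by (metis surj_pair)
  note m = assms(1)[unfolded e survivors1_def, simplified]
  from assms(2)[unfolded e] obtain a1 a2 a3 a4 where a: "(a1, a2, a3, a4) \<in> set digits"
    "3 * n1 + 2 = 7 * a1 + m1" "3 * n2 + 0 = 7 * a2 + m2" "3 * n3 + 2 = 7 * a3 + m3" "3 * n4 + 1 = 7 * a4 + m4"
    by (rule hitE)
  have "(3 * n1 + 2) + (3 * n2 + 0) + (3 * n3 + 2) + (3 * n4 + 1) =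
      (7 * a1 + m1) + (7 * a2 + m2) + (7 * a3 + m3) + (7 * a4 + m4)"
    by (simp only: a(2-5))
  then have "3 * (n1 + n2 + n3 + n4) + 5 = 7 * (a1 + a2 + a3 + a4) + (m1 + m2 + m3 + m4)"
    by (simp add: algebra_simps)
  then have "3 * (n1 + n2 + n3 + n4) \<le> 15" using conjunct1[OF m] sum_digits[OF a(1)] by simp
  then have s: "n1 + n2 + n3 + n4 \<le> 5" by simp
  \<comment> \<open>Named after the residue: the value at a digit \<open>a\<close> is the least
    \<open>x\<close> for which \<open>3x\<close> plus that residue is at least
    \<open>7a\<close>.\<close>
  define l2 where "l2 a = (if a = (0::nat) then (0::nat) else if a = 1 then 2 else 4)" for a
  define l0 where "l0 a = (if a = (0::nat) then (0::nat) else if a = 1 then 3 else 5)" for a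
  define l1 where "l1 a = (if a = (0::nat) then (0::nat) else if a = 1 then 2 else 5)" for a
  have le: "a1 \<le> 2" "a2 \<le> 2" "a3 \<le> 2" "a4 \<le> 2" using sum_digits[OF a(1)] by auto
  have l: "l2 a \<le> x" if "3 * x + 2 = 7 * a + y" "a \<le> 2" for x y a
    using that unfolding l2_def by auto
  have l': "l0 a \<le> x" if "3 * x + 0 = 7 * a + y" "a \<le> 2" for x y a
  proof -
    have "a = 0 \<or> a = 1 \<or> a = 2" using that(2) by auto
    with that(1) show ?thesis unfolding l0_def by (elim disjE; simp; presburger)
  qed
  have l'': "l1 a \<le> x" if "3 * x + 1 = 7 * a + y" "a \<le> 2" for x y a
  proof -
    have "a = 0 \<or> a = 1 \<or> a = 2" using that(2) by auto
    with that(1) show ?thesis unfolding l1_def by (elim disjE; simp; presburger)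
  qed
  have lb: "4 \<le> l2 a1 + l0 a2 + l2 a3 + l1 a4"
    using a(1) by (auto simp: digits_def l2_def l0_def l1_def)
  have m_eq: "m1 = 3 * n1 + 2 - 7 * a1" "m2 = 3 * n2 - 7 * a2" "m3 = 3 * n3 + 2 - 7 * a3" "m4 = 3 * n4 + 1 - 7 * a4"
    using a(2-5) by simp_all
  have m': "(3 * n1 + 2 - 7 * a1, 3 * n2 - 7 * a2, 3 * n3 + 2 - 7 * a3, 3 * n4 + 1 - 7 * a4) \<in> survivors1"
    using assms(1) unfolding e m_eq .
  have "\<forall>(b1, b2, b3, b4)\<in>set digits. \<forall>(t1, t2, t3, t4)\<in>{(0,0,0,0), (1,0,0,0), (0,1,0,0), (0,0,1,0), (0,0,0,1)}.
      (3 * (l2 b1 + t1) + 2 - 7 * b1, 3 * (l0 b2 + t2) - 7 * b2, 3 * (l2 b3 + t3) + 2 - 7 * b3,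
       3 * (l1 b4 + t4) + 1 - 7 * b4) \<in> survivors1 \<longrightarrow> (l2 b1 + t1, l0 b2 + t2, l2 b3 + t3, l1 b4 + t4) \<in> survivors2"
    by (simp add: digits_def l2_def l0_def l1_def) (simp add: survivors1_def survivors2_def)
  from bspec[OF this a(1)]
  have "\<forall>(t1, t2, t3, t4)\<in>{(0,0,0,0), (1,0,0,0), (0,1,0,0), (0,0,1,0), (0,0,0,1)}.
      (3 * (l2 a1 + t1) + 2 - 7 * a1, 3 * (l0 a2 + t2) - 7 * a2, 3 * (l2 a3 + t3) + 2 - 7 * a3,
       3 * (l1 a4 + t4) + 1 - 7 * a4) \<in> survivors1 \<longrightarrow> (l2 a1 + t1, l0 a2 + t2, l2 a3 + t3, l1 a4 + t4) \<in> survivors2"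
    by (simp only: prod.case)
  moreover obtain t1 t2 t3 t4 where "n1 = l2 a1 + t1" "n2 = l0 a2 + t2" "n3 = l2 a3 + t3" "n4 = l1 a4 + t4"
    "(t1, t2, t3, t4) \<in> {(0,0,0,0), (1,0,0,0), (0,1,0,0), (0,0,1,0), (0,0,0,1)}"
    by (rule candidates[OF l[OF a(2) le(1)] l'[OF a(3) le(2)] l[OF a(4) le(3)] l''[OF a(5) le(4)] s lb])
  ultimately show ?thesis using m' unfolding e by blast
qed

text \<open>As 7 is 1 modulo 3, residue and exponent determine each digit. Only
  \<open>(0, 0, 4, 1)\<close> yields digits of sum 2: the second digit is always 2, so the first
  must vanish.\<close>

lemma hit_survivors3:
  assumes "m \<in> survivors2" "hit (0, 2, 1, 1) m n"
  shows "n = (0, 4, 1, 0)"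
proof -
  obtain m1 m2 m3 m4 n1 n2 n3 n4 where e: "m = (m1, m2, m3, m4)" "n = (n1, n2, n3, n4)"
    by (metis surj_pair)
  from assms(2)[unfolded e] obtain a1 a2 a3 a4 where a: "(a1, a2, a3, a4) \<in> set digits"
    "3 * n1 + 0 = 7 * a1 + m1" "3 * n2 + 2 = 7 * a2 + m2" "3 * n3 + 1 = 7 * a3 + m3" "3 * n4 + 1 = 7 * a4 + m4"
    by (rule hitE)
  have le: "a1 \<le> 2" "a2 \<le> 2" "a3 \<le> 2" "a4 \<le> 2" using sum_digits[OF a(1)] by auto
  have "a = (r + 2 * m) mod 3" if "3 * n + r = 7 * a + m" "a \<le> 2" for n r a m :: nat
  proof -
    have "r + 2 * m + 3 * (5 * a) = a + 3 * (2 * n + r)" using that(1) by simp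
    then have "(r + 2 * m + 3 * (5 * a)) mod 3 = (a + 3 * (2 * n + r)) mod 3" by (rule arg_cong)
    then show ?thesis using that(2) unfolding mod_mult_self2 by simp
  qed
  note q = this[OF a(2) le(1)] this[OF a(3) le(2)] this[OF a(4) le(3)] this[OF a(5) le(4)]
  have "m1 = 0 \<and> m2 = 0 \<and> m3 = 4 \<and> m4 = 1 \<or> m1 = 1 \<and> m2 = 0 \<and> m3 = 2 \<and> m4 = 2 \<or>
      m1 = 1 \<and> m2 = 0 \<and> m3 = 4 \<and> m4 = 0 \<or> m1 = 2 \<and> m2 = 0 \<and> m3 = 1 \<and> m4 = 2 \<or>
      m1 = 2 \<and> m2 = 0 \<and> m3 = 2 \<and> m4 = 1 \<or> m1 = 4 \<and> m2 = 0 \<and> m3 = 0 \<and> m4 = 1 \<or>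
      m1 = 4 \<and> m2 = 0 \<and> m3 = 1 \<and> m4 = 0"
    using assms(1) by (simp add: survivors2_def e)
  then show ?thesis using q sum_digits[OF a(1)] a(2-5) unfolding e
    by (elim disjE conjE; simp)
qed

lemma achieves_0410:
  fixes T :: "'k::field poly4 set"
  assumes "stable T" "CHAR('k) = 3" "achieves T (box 6 6) (6, 0, 0, 0)"
  shows "achieves T {(0, 4, 1, 0)} (0, 4, 1, 0)"
proof -
  note step = achieves_step[OF stable_trace_maps[OF assms(1)] assms(2)]
  have "achieves T {n'. \<exists>m'\<in>box 6 6. hit (0, 0, 0, 2) m' n'} (2, 0, 0, 4)"
    by (rule step[OF assms(3)]) (auto simp: digits_def)
  then have "achieves T survivors1 (2, 0, 0, 4)"
    by (rule achieves_mono) (auto intro: hit_survivors1 simp del: hit.simps)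
  then have "achieves T {n'. \<exists>m'\<in>survivors1. hit (2, 0, 2, 1) m' n'} (0, 0, 4, 1)"
    by (rule step) (auto simp: digits_def)
  then have "achieves T survivors2 (0, 0, 4, 1)"
    by (rule achieves_mono) (auto intro: hit_survivors2 simp del: hit.simps)
  then have "achieves T {n'. \<exists>m'\<in>survivors2. hit (0, 2, 1, 1) m' n'} (0, 4, 1, 0)"
    by (rule step) (auto simp: digits_def)
  then show ?thesis
    by (rule achieves_mono) (auto dest: hit_survivors3 simp del: hit.simps)
qed

subsection \<open>Monomials\<close>

lemma digits_le: "(a1, a2, a3, a4) \<in> set digits \<Longrightarrow> a1 \<le> 2 \<and> a2 \<le> 2 \<and> a3 \<le> 2 \<and> a4 \<le> 2"
  by (auto simp: digits_def)

text \<open>As 7 is 1 modulo 3, digits at most 2 are told apart by their residues. A suitable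
  residue class thus selects one monomial of \<open>hypf ^ 2\<close>, and a monomial goes to a
  single monomial.\<close>

lemma achieves_monomial_step:
  fixes T :: "'k::field poly4 set"
  assumes "trace_maps T T'" "CHAR('k) = 3" "achieves T {(m1, m2, m3, m4)} (m1, m2, m3, m4)"
    and a: "(a1, a2, a3, a4) \<in> set digits"
  defines "n \<equiv> ((7 * a1 + m1) div 3, (7 * a2 + m2) div 3, (7 * a3 + m3) div 3, (7 * a4 + m4) div 3)"
  shows "achieves T' {n} n"
proof -
  let ?r = "((7 * a1 + m1) mod 3, (7 * a2 + m2) mod 3, (7 * a3 + m3) mod 3, (7 * a4 + m4) mod 3)"
  have dm: "3 * (x div 3) + x mod 3 = x" for x :: nat by simp
  have "hit ?r (m1, m2, m3, m4) n"
    unfolding n_def hit.simps dm using a by (intro bexI[OF _ a]) simp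
  moreover have "small ?r" by simp linarith
  ultimately have "achieves T' {n'. \<exists>m'\<in>{(m1, m2, m3, m4)}. hit ?r m' n'} n"
    by (intro achieves_step[OF assms(1-3)]) auto
  moreover have "n' = n" if h: "hit ?r (m1, m2, m3, m4) n'" for n'
  proof -
    obtain n1 n2 n3 n4 where e: "n' = (n1, n2, n3, n4)" by (metis surj_pair)
    have key: "y = (7 * a + m) div 3" if "3 * y + (7 * a + m) mod 3 = 7 * b + m" "a \<le> 2" "b \<le> 2"
      for y a b m :: nat
    proof -
      have "a = 0 \<or> a = 1 \<or> a = 2" "b = 0 \<or> b = 1 \<or> b = 2" using that(2,3) by auto
      with that(1) show ?thesis by (elim disjE; simp; presburger)
    qed
    from h obtain b1 b2 b3 b4 where b: "(b1, b2, b3, b4) \<in> set digits"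
      "3 * n1 + (7 * a1 + m1) mod 3 = 7 * b1 + m1" "3 * n2 + (7 * a2 + m2) mod 3 = 7 * b2 + m2"
      "3 * n3 + (7 * a3 + m3) mod 3 = 7 * b3 + m3" "3 * n4 + (7 * a4 + m4) mod 3 = 7 * b4 + m4"
      unfolding e by auto
    show ?thesis
      unfolding e n_def using digits_le[OF a] digits_le[OF b(1)]
        key[OF b(2)] key[OF b(3)] key[OF b(4)] key[OF b(5)] by simp
  qed
  ultimately show ?thesis by (elim achieves_mono) auto
qed

lemma achieves_singleD:
  fixes T :: "'k::field poly4 set"
  assumes "P.subspace T" "achieves T {m} m"
  shows "pmonom (xp m) c \<in> T"
proof -
  obtain g where g: "g \<in> T" "xp m \<in> Poly_Mapping.keys g" "Poly_Mapping.keys g \<subseteq> {xp m}"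
    using assms(2) unfolding achieves_def by auto
  have "g = pmonom (xp m) (pcoeff g (xp m))"
    using g by (intro poly_mapping_eqI) (auto simp: lookup_single when_def in_keys_iff)
  moreover have "pcoeff g (xp m) \<noteq> 0" using g by (simp add: in_keys_iff)
  ultimately have "pmonom (xp m) c = pmonom 0 (c / pcoeff g (xp m)) * g"
    by (metis add_0 mult_single nonzero_divide_eq_eq)
  then show ?thesis using P.subspace_scale[OF assms(1) g(1)] by metis
qed

text \<open>The exponents of the products \<open>x_i^2 x_j^2\<close>, that is, the doubled
  \<open>digits\<close>.\<close>

definition quartics :: "quad list" where
  "quartics = [(4,0,0,0), (0,4,0,0), (0,0,4,0), (0,0,0,4), (2,2,0,0), (2,0,2,0), (2,0,0,2),
     (0,2,2,0), (0,2,0,2), (0,0,2,2)]"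

text \<open>Under \<open>(7a + m) div 3\<close>, digit 0 kills exponents up to 2, digit 1 turns 0
  and 1 into 2, and digit 2 turns 0 into 4. The chain visits monomials to which one of these cases
  applies in every coordinate.\<close>

lemma achieves_quartics:
  fixes T :: "'k::field poly4 set"
  assumes "stable T" "CHAR('k) = 3" "achieves T {(0, 4, 1, 0)} (0, 4, 1, 0)"
    and "m \<in> set quartics"
  shows "achieves T {m} m"
proof -
  let ?A = "\<lambda>m. achieves T {m} m"
  note step = achieves_monomial_step[OF stable_trace_maps[OF assms(1)] assms(2)]
  have 1: "?A (0, 1, 2, 2)" using step[OF assms(3), of 0 0 1 1] by (simp add: digits_def)
  have a: "?A (2, 2, 0, 0)" using step[OF 1, of 1 1 0 0] by (simp add: digits_def)
  have b: "?A (4, 0, 0, 0)" using step[OF 1, of 2 0 0 0] by (simp add: digits_def)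
  have c: "?A (0, 0, 2, 2)" "?A (0, 0, 4, 0)" "?A (0, 0, 0, 4)"
    using step[OF a, of 0 0 1 1] step[OF a, of 0 0 2 0] step[OF a, of 0 0 0 2] by (simp_all add: digits_def)
  have d: "?A (0, 4, 0, 0)" using step[OF c(1), of 0 2 0 0] by (simp add: digits_def)
  have 2: "?A (1, 2, 2, 0)" "?A (1, 2, 0, 2)"
    using step[OF b, of 0 1 1 0] step[OF b, of 0 1 0 1] by (simp_all add: digits_def)
  have e: "?A (2, 0, 0, 2)" "?A (2, 0, 2, 0)"
    using step[OF 2(1), of 1 0 0 1] step[OF 2(2), of 1 0 1 0] by (simp_all add: digits_def)
  have f: "?A (0, 2, 2, 0)" "?A (0, 2, 0, 2)"
    using step[OF e(1), of 0 1 1 0] step[OF e(2), of 0 1 0 1] by (simp_all add: digits_def)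
  show ?thesis
    using assms(4) a b c d e f unfolding quartics_def by auto
qed

text \<open>Every generator arises in one step from another generator with exponent 0 at the
  variables of the chosen digits. This is what lets the threshold on \<open>q\<close> be lowered one
  unit at a time.\<close>

lemma achieves_quartics_descend:
  fixes T :: "'k::field poly4 set"
  assumes "trace_maps T T'" "CHAR('k) = 3" and q: "\<And>m. m \<in> set quartics \<Longrightarrow> achieves T {m} m"
    and "m \<in> set quartics"
  shows "achieves T' {m} m"
proof -
  let ?A = "\<lambda>m. achieves T' {m} m"
  note step = achieves_monomial_step[OF assms(1,2)]
  have A: "achieves T {(0,0,2,2)} (0,0,2,2)" "achieves T {(2,2,0,0)} (2,2,0,0)"
    "achieves T {(0,2,2,0)} (0,2,2,0)" "achieves T {(2,0,0,2)} (2,0,0,2)"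
    "achieves T {(0,2,0,2)} (0,2,0,2)" "achieves T {(2,0,2,0)} (2,0,2,0)"
    by (rule q, simp add: quartics_def)+
  have "?A (2,2,0,0)" "?A (4,0,0,0)" "?A (0,4,0,0)"
    using step[OF A(1), of 1 1 0 0] step[OF A(1), of 2 0 0 0] step[OF A(1), of 0 2 0 0]
    by (simp_all add: digits_def)
  moreover have "?A (0,0,2,2)" "?A (0,0,4,0)" "?A (0,0,0,4)"
    using step[OF A(2), of 0 0 1 1] step[OF A(2), of 0 0 2 0] step[OF A(2), of 0 0 0 2]
    by (simp_all add: digits_def)
  moreover have "?A (2,0,0,2)" "?A (0,2,2,0)" "?A (2,0,2,0)" "?A (0,2,0,2)"
    using step[OF A(3), of 1 0 0 1] step[OF A(4), of 0 1 1 0] step[OF A(5), of 1 0 1 0] step[OF A(6), of 0 1 0 1]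
    by (simp_all add: digits_def)
  ultimately show ?thesis
    using assms(4) unfolding quartics_def by auto
qed

subsection \<open>Division by the hypersurface equation\<close>

lemma hypf_eq4: "(hypf :: 'k::field poly4) = pmonom (E 0) 1 + pmonom (E 1) 1 + pmonom (E 2) 1 + pmonom (E 3) 1"
  unfolding hypf_eq UNIV_4 by (simp add: add.assoc del: single_numeral)

lemma ball_keys_add:
  assumes "\<forall>m\<in>Poly_Mapping.keys f. P m" "\<forall>m\<in>Poly_Mapping.keys g. P m"
  shows "\<forall>m\<in>Poly_Mapping.keys (f + g). P m"
proof
  fix m assume "m \<in> Poly_Mapping.keys (f + g)"
  then have "m \<in> Poly_Mapping.keys f \<or> m \<in> Poly_Mapping.keys g" using keys_add[of f g] by auto
  then show "P m" using assms by auto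
qed

text \<open>\<open>hypf\<close> is monic of degree 7 in \<open>Var 0\<close>, so this is division
  with remainder: the seventh power of \<open>Var 0\<close> is replaced by minus the sum of the
  others, which lowers the exponent of \<open>Var 0\<close>.\<close>

lemma normal_form:
  fixes g :: "'k::field poly4"
  shows "\<exists>h. hypf dvd g - h \<and> (\<forall>m\<in>Poly_Mapping.keys h. Poly_Mapping.lookup m 0 \<le> 6)"
proof (induction g rule: poly4_induct)
  case (pmonom m c)
  show ?case
  proof (induction "Poly_Mapping.lookup m 0" arbitrary: m c rule: less_induct)
    case less
    show ?case
    proof (cases "Poly_Mapping.lookup m 0 \<le> 6")
      case True
      then show ?thesis by (intro exI[of _ "pmonom m c"]) (auto split: if_splits)
    next
      case False
      define n where "n = m - E 0"
      have m: "m = E 0 + n"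
        using False unfolding n_def
        by (intro poly_mapping_eqI) (auto simp: lookup_add lookup_minus lookup_single when_def simp del: single_numeral)
      have ex: "\<exists>h. hypf dvd pmonom (E i + n) (- c) - h \<and> (\<forall>m\<in>Poly_Mapping.keys h. Poly_Mapping.lookup m 0 \<le> 6)"
        if "i \<noteq> 0" for i
        using that by (intro less) (simp add: m lookup_add lookup_single del: single_numeral)
      obtain h1 where h1: "hypf dvd pmonom (E 1 + n) (- c) - h1" "\<forall>m\<in>Poly_Mapping.keys h1. Poly_Mapping.lookup m 0 \<le> 6"
        using ex[of 1] by auto
      obtain h2 where h2: "hypf dvd pmonom (E 2 + n) (- c) - h2" "\<forall>m\<in>Poly_Mapping.keys h2. Poly_Mapping.lookup m 0 \<le> 6"
        using ex[of 2] by auto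
      obtain h3 where h3: "hypf dvd pmonom (E 3 + n) (- c) - h3" "\<forall>m\<in>Poly_Mapping.keys h3. Poly_Mapping.lookup m 0 \<le> 6"
        using ex[of 3] by auto
      note h = h1(1) h2(1) h3(1) and hk = h1(2) h2(2) h3(2)
      have "pmonom m c - (h1 + h2 + h3) = hypf * pmonom n c + (pmonom (E 1 + n) (- c) - h1)
          + (pmonom (E 2 + n) (- c) - h2) + (pmonom (E 3 + n) (- c) - h3)"
        unfolding hypf_eq4 m by (simp add: distrib_right mult_single single_uminus del: single_numeral)
      moreover have "hypf dvd hypf * pmonom n c + (pmonom (E 1 + n) (- c) - h1)
          + (pmonom (E 2 + n) (- c) - h2) + (pmonom (E 3 + n) (- c) - h3)"
        by (intro dvd_add dvd_triv_left h)
      ultimately have "hypf dvd pmonom m c - (h1 + h2 + h3)" by (simp only:)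
      moreover have "\<forall>m\<in>Poly_Mapping.keys (h1 + h2 + h3). Poly_Mapping.lookup m 0 \<le> 6"
        by (intro ball_keys_add hk)
      ultimately show ?thesis by blast
    qed
  qed
next
  case (add g g')
  then obtain h h' where h: "hypf dvd g - h" "\<forall>m\<in>Poly_Mapping.keys h. Poly_Mapping.lookup m 0 \<le> 6"
    "hypf dvd g' - h'" "\<forall>m\<in>Poly_Mapping.keys h'. Poly_Mapping.lookup m 0 \<le> 6" by auto
  have "hypf dvd (g + g') - (h + h')"
    using dvd_add[OF h(1,3)] by (simp add: algebra_simps)
  moreover have "\<forall>m\<in>Poly_Mapping.keys (h + h'). Poly_Mapping.lookup m 0 \<le> 6"
    by (intro ball_keys_add h)
  ultimately show ?case by blast
qed

lemma exists_max_key: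
  fixes g :: "'k::field poly4"
  assumes "g \<noteq> 0"
  obtains m where "m \<in> Poly_Mapping.keys g"
    "\<And>n. n \<in> Poly_Mapping.keys g \<Longrightarrow> Poly_Mapping.lookup n i \<le> Poly_Mapping.lookup m i"
proof -
  let ?A = "(\<lambda>n. Poly_Mapping.lookup n i) ` Poly_Mapping.keys g"
  have "finite ?A" "?A \<noteq> {}" using assms by auto
  then have "Max ?A \<in> ?A" by (rule Max_in)
  then obtain m where "m \<in> Poly_Mapping.keys g" "Max ?A = Poly_Mapping.lookup m i" by blast
  moreover have "Poly_Mapping.lookup n i \<le> Max ?A" if "n \<in> Poly_Mapping.keys g" for n
    using that by (intro Max_ge \<open>finite ?A\<close>) blast
  ultimately show ?thesis by (intro that[of m]) auto
qed

text \<open>A term of \<open>w\<close> of largest degree in \<open>Var 0\<close>, times the seventh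
  power of \<open>Var 0\<close>, meets no other term of the product.\<close>

lemma hypf_multiple_degree:
  fixes w :: "'k::field poly4"
  assumes "w \<noteq> 0"
  shows "\<exists>m\<in>Poly_Mapping.keys (hypf * w). 7 \<le> Poly_Mapping.lookup m 0"
proof -
  obtain m where m: "m \<in> Poly_Mapping.keys w"
    "\<And>n. n \<in> Poly_Mapping.keys w \<Longrightarrow> Poly_Mapping.lookup n 0 \<le> Poly_Mapping.lookup m 0"
    using exists_max_key[OF assms] by blast
  have "pcoeff (pmonom (E i) 1 * w) (E 0 + m) = 0" if "i \<noteq> 0" for i
  proof (cases "\<exists>k. E 0 + m = E i + k")
    case True
    then obtain k where k: "E 0 + m = E i + k" by blast
    then have "Poly_Mapping.lookup (E 0 + m) 0 = Poly_Mapping.lookup (E i + k) 0" by simp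
    with that have "Poly_Mapping.lookup k 0 = Poly_Mapping.lookup m 0 + 7"
      by (simp add: lookup_add lookup_single del: single_numeral)
    with m(2)[of k] have "pcoeff w k = 0" by (force simp: in_keys_iff)
    then show ?thesis using coeff_monom_mult[of "E i" 1 w k] unfolding k by simp
  next
    case False
    then show ?thesis by (intro coeff_monom_mult_0) blast
  qed
  then have "pcoeff (hypf * w) (E 0 + m) = pcoeff w m"
    unfolding hypf_eq4 distrib_right lookup_add
    by (simp add: coeff_monom_mult del: single_numeral)
  with m(1) have "E 0 + m \<in> Poly_Mapping.keys (hypf * w)" by (simp add: in_keys_iff)
  then show ?thesis by (intro bexI[of _ "E 0 + m"]) (simp_all add: lookup_add del: single_numeral)
qed

subsection \<open>Stable ideals\<close>

lemma subspace_hypf_multiple: "P.subspace T \<Longrightarrow> hypf \<in> T \<Longrightarrow> hypf dvd g \<Longrightarrow> g \<in> T"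
  by (metis P.subspace_scale dvdE mult.commute)

text \<open>Modulo \<open>hypf\<close> the element \<open>g\<close> becomes a nonzero remainder of
  degree at most 6 in \<open>Var 0\<close>, where the contraction can start.\<close>

lemma stable_achieves_quartics:
  fixes T :: "'k::field poly4 set"
  assumes st: "stable T" and ch: "CHAR('k) = 3" and g: "g \<in> T" "\<not> hypf dvd g" and m: "m \<in> set quartics"
  shows "achieves T {m} m"
proof -
  obtain h where h: "hypf dvd g - h" "\<forall>m\<in>Poly_Mapping.keys h. Poly_Mapping.lookup m 0 \<le> 6"
    using normal_form by blast
  have T: "P.subspace T" "hypf \<in> T" using st by (auto simp: stable_def)
  have "g - (g - h) \<in> T"
    by (rule P.subspace_diff[OF T(1) g(1) subspace_hypf_multiple[OF T h(1)]])
  then have "h \<in> T" by simp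
  have "h \<noteq> 0" using g h(1) by auto
  then obtain k where k: "k \<in> Poly_Mapping.keys h"
    "\<And>n. n \<in> Poly_Mapping.keys h \<Longrightarrow> Poly_Mapping.lookup n 0 \<le> Poly_Mapping.lookup k 0"
    using exists_max_key by blast
  obtain a b c d where abcd: "k = xp (a, b, c, d)" by (rule xp_cases)
  \<comment> \<open>A crude degree bound: the sum of the degrees of all monomials of
    \<open>h\<close>.\<close>
  define D where "D = (\<Sum>n\<in>Poly_Mapping.keys h. \<Sum>i\<in>UNIV. Poly_Mapping.lookup n i)"
  have "Poly_Mapping.keys h \<subseteq> xp ` box a D"
  proof
    fix n assume n: "n \<in> Poly_Mapping.keys h"
    obtain a' b' c' d' where n': "n = xp (a', b', c', d')" by (rule xp_cases)
    have "(\<Sum>i\<in>UNIV. Poly_Mapping.lookup n i) \<le> D"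
      unfolding D_def using n by (intro member_le_sum) auto
    moreover have "(\<Sum>i\<in>UNIV. Poly_Mapping.lookup n i) = a' + b' + c' + d'"
      unfolding UNIV_4 n' by simp
    ultimately have "a' + b' + c' + d' \<le> D" by simp
    moreover have "a' \<le> a" using k(2)[OF n] by (simp add: n' abcd)
    ultimately show "n \<in> xp ` box a D" unfolding n' box_def by auto
  qed
  with k \<open>h \<in> T\<close> have "achieves T (box a D) (a, b, c, d)"
    unfolding achieves_def abcd by blast
  moreover have "a \<le> 6" using h(2) k(1) by (auto simp: abcd)
  ultimately have "achieves T (box 6 6) (6, 0, 0, 0)"
    by (rule achieves_box_6[OF st ch])
  from achieves_quartics[OF st ch achieves_0410[OF st ch this] m]
  show ?thesis .
qed

text \<open>The factor \<open>hypf ^ 2\<close> completes a multiple of \<open>hypf\<close> to a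
  multiple of its cube, so the trace maps descend to the quotient ring.\<close>

lemma ctr_hypf_cube:
  assumes "semilin l" "\<forall>i. Poly_Mapping.lookup r i \<le> 2" "CHAR('k::field) = 3"
  shows "ctr l r (hypf ^ 2 * (hypf * w)) = hypf * ctr l r (w :: 'k poly4)"
proof -
  have "hypf ^ 2 * (hypf * w) = hypf ^ 3 * w" by (simp add: power2_eq_square power3_eq_cube mult_ac)
  then show ?thesis using ctr_cube_mult[OF assms] by metis
qed

text \<open>A cube \<open>b ^ 3\<close> inside the trace map comes out as \<open>b\<close>, and
  \<open>b ^ 3 * t\<close> is a multiple of \<open>hypf\<close> whenever \<open>t * b\<close>
  is.\<close>

lemma stable_annihilator:
  fixes b :: "'k::field poly4"
  assumes ch: "CHAR('k) = 3"
  shows "stable {t. hypf dvd t * b}"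
proof -
  have "hypf dvd ctr l r (hypf ^ 2 * t) * b"
    if l: "semilin l" "\<forall>i. Poly_Mapping.lookup r i \<le> 2" and t: "hypf dvd t * b" for l r t
  proof -
    obtain w where w: "t * b = hypf * w" using t by blast
    have "ctr l r (hypf ^ 2 * t) * b = ctr l r (b ^ 3 * (hypf ^ 2 * t))"
      by (simp add: ctr_cube_mult[OF l ch] mult.commute)
    also have "b ^ 3 * (hypf ^ 2 * t) = hypf ^ 2 * ((t * b) * b ^ 2)"
      by (simp add: power2_eq_square power3_eq_cube mult_ac)
    also have "\<dots> = hypf ^ 2 * (hypf * (w * b ^ 2))" unfolding w by (simp add: mult_ac)
    finally show ?thesis using ctr_hypf_cube[OF l ch] by simp
  qed
  then show ?thesis
    unfolding stable_def trace_maps_def P.subspace_def by (auto simp: distrib_right mult.assoc)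
qed

text \<open>If \<open>b\<close> is not a multiple of \<open>hypf\<close>, the ideal
  \<open>(hypf) : a\<close> contains \<open>Var 1 ^ 4\<close>. The remainder \<open>h\<close> of
  \<open>a\<close> times this power is a multiple of \<open>hypf\<close> of degree at most 6 in
  \<open>Var 0\<close>, hence zero.\<close>

theorem hypf_prime:
  fixes a b :: "'k::field poly4"
  assumes ch: "CHAR('k) = 3" and ab: "hypf dvd a * b"
  shows "hypf dvd a \<or> hypf dvd b"
proof (rule disjCI)
  assume "\<not> hypf dvd b"
  let ?T = "{t. hypf dvd t * a}"
  \<comment> \<open>A generator free of \<open>Var 0\<close> is chosen, since multiplying by it
    leaves the degree in \<open>Var 0\<close> unchanged.\<close>
  have "achieves ?T {(0, 4, 0, 0)} (0, 4, 0, 0)"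
    using stable_achieves_quartics[OF stable_annihilator[OF ch], of b a "(0, 4, 0, 0)"] ab ch \<open>\<not> hypf dvd b\<close>
    by (simp add: quartics_def mult.commute)
  with stable_annihilator[OF ch] have X: "pmonom (xp (0, 4, 0, 0)) 1 \<in> ?T"
    by (intro achieves_singleD) (simp_all add: stable_def)
  obtain h where h: "hypf dvd a - h" "\<forall>m\<in>Poly_Mapping.keys h. Poly_Mapping.lookup m 0 \<le> 6"
    using normal_form by blast
  let ?X = "pmonom (xp (0, 4, 0, 0)) 1 :: 'k poly4"
  have "?X * h = ?X * a - ?X * (a - h)" by (simp add: algebra_simps)
  then have "hypf dvd ?X * h" using X h(1) by (metis dvd_diff dvd_mult mem_Collect_eq)
  then obtain w where w: "?X * h = hypf * w" by blast
  have "Poly_Mapping.lookup m 0 \<le> 6" if "m \<in> Poly_Mapping.keys (?X * h)" for m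
  proof -
    from that keys_mult[of ?X h] obtain n where "n \<in> Poly_Mapping.keys h" "m = xp (0, 4, 0, 0) + n" by auto
    then show ?thesis using h(2) by (simp add: lookup_add)
  qed
  moreover have "\<exists>m\<in>Poly_Mapping.keys (?X * h). 7 \<le> Poly_Mapping.lookup m 0" if "w \<noteq> 0"
    using hypf_multiple_degree[OF that] unfolding w .
  ultimately have "w = 0" by fastforce
  with w have "?X * h = 0" by simp
  moreover have "?X \<noteq> 0" by (metis lookup_single_eq lookup_zero zero_neq_one)
  ultimately have "h = 0" by (metis mult_eq_0_iff)
  with h(1) show "hypf dvd a" by simp
qed

subsection \<open>Monomial ideals\<close>

lemma mult_in_span: "(x :: 'k::field poly4) \<in> A \<Longrightarrow> c * x \<in> P.span A"
  by (intro P.span_scale P.span_base)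

lemma poly4_sum_monoms: "(g :: 'k::field poly4) = (\<Sum>m\<in>Poly_Mapping.keys g. pmonom m (pcoeff g m))"
proof (rule poly_mapping_eqI)
  fix n
  have "pcoeff (\<Sum>m\<in>Poly_Mapping.keys g. pmonom m (pcoeff g m)) n =
      (\<Sum>m\<in>Poly_Mapping.keys g. if m = n then pcoeff g m else 0)"
    unfolding lookup_sum by (intro sum.cong) (auto simp: lookup_single when_def)
  also have "\<dots> = pcoeff g n" by (simp add: in_keys_iff)
  finally show "pcoeff g n = pcoeff (\<Sum>m\<in>Poly_Mapping.keys g. pmonom m (pcoeff g m)) n" by simp
qed

lemma subspace_keys:
  assumes "\<And>m k. m \<in> M \<Longrightarrow> k + m \<in> M"
  shows "P.subspace {g :: 'k::field poly4. Poly_Mapping.keys g \<subseteq> M}"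
proof (rule P.subspaceI)
  fix x y :: "'k poly4"
  assume "x \<in> {g. Poly_Mapping.keys g \<subseteq> M}" "y \<in> {g. Poly_Mapping.keys g \<subseteq> M}"
  then show "x + y \<in> {g. Poly_Mapping.keys g \<subseteq> M}" using keys_add[of x y] by blast
next
  fix x c :: "'k poly4"
  assume "x \<in> {g. Poly_Mapping.keys g \<subseteq> M}"
  then show "c * x \<in> {g. Poly_Mapping.keys g \<subseteq> M}" using keys_mult[of c x] assms by blast
qed simp

lemma subspace_of_monoms:
  assumes "P.subspace T" "\<And>m. m \<in> Poly_Mapping.keys g \<Longrightarrow> pmonom m 1 \<in> T"
  shows "g \<in> T"
proof -
  have "pmonom m c \<in> T" if "m \<in> Poly_Mapping.keys g" for m c
    using P.subspace_scale[OF assms(1) assms(2)[OF that], of "pmonom 0 c"] by (simp add: mult_single)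
  then have "(\<Sum>m\<in>Poly_Mapping.keys g. pmonom m (pcoeff g m)) \<in> T"
    by (intro P.subspace_sum[OF assms(1)])
  then show ?thesis using poly4_sum_monoms[of g] by simp
qed

abbreviation square_products :: "'k::field poly4 set" where
  "square_products \<equiv> {Var i ^ 2 * Var j ^ 2 | i j. True}"

text \<open>Modulo the squares of the other variables, \<open>x\<^sub>i\<^sup>7\<close> vanishes on the hypersurface, so
  multiplying by \<open>x\<^sub>i\<^sup>3\<close> detects the exponent 4 of \<open>x\<^sub>i\<close>.\<close>

lemma cube_colon:
  fixes g :: "'k::field poly4"
  assumes "\<And>i. g * Var i ^ 3 \<in> P.span (insert hypf {Var j ^ 2 | j. j \<noteq> i})"
  shows "g \<in> P.span square_products"
proof (rule subspace_of_monoms[OF P.subspace_span])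
  fix m assume m: "m \<in> Poly_Mapping.keys g"
  have le: "4 \<le> Poly_Mapping.lookup m i \<or> (\<exists>j. j \<noteq> i \<and> 2 \<le> Poly_Mapping.lookup m j)" for i
  proof -
    \<comment> \<open>The exponents of the monomial ideal of \<open>x_i^7\<close> and the other
      squares \<open>x_j^2\<close>; it contains \<open>hypf\<close> and all the given
      generators.\<close>
    define M :: "(4 \<Rightarrow>\<^sub>0 nat) set" where "M = {m. 7 \<le> Poly_Mapping.lookup m i \<or> (\<exists>j. j \<noteq> i \<and> 2 \<le> Poly_Mapping.lookup m j)}"
    have E_M: "E j \<in> M" for j
    proof (cases "j = i")
      case False
      then show ?thesis unfolding M_def by (auto simp: lookup_single intro!: exI[of _ j] simp del: single_numeral)
    qed (simp add: M_def)
    have "P.subspace {g :: 'k poly4. Poly_Mapping.keys g \<subseteq> M}"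
      by (rule subspace_keys) (auto simp: M_def lookup_add intro: add_increasing)
    moreover have "hypf \<in> {g :: 'k poly4. Poly_Mapping.keys g \<subseteq> M}"
      unfolding hypf_eq using E_M by (intro P.subspace_sum[OF calculation]) simp
    moreover have "Var j ^ 2 \<in> {g :: 'k poly4. Poly_Mapping.keys g \<subseteq> M}" if "j \<noteq> i" for j
      unfolding Var_power using that
      by (auto simp: M_def lookup_single when_def intro!: exI[of _ j] simp del: single_numeral)
    ultimately have "P.span (insert hypf {Var j ^ 2 | j. j \<noteq> i}) \<subseteq> {g :: 'k poly4. Poly_Mapping.keys g \<subseteq> M}"
      by (intro P.span_minimal) blast+
    with assms[of i] have k: "Poly_Mapping.keys (g * Var i ^ 3) \<subseteq> M" by blast
    have "pcoeff (g * Var i ^ 3) (Poly_Mapping.single i 3 + m) = pcoeff g m"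
      using coeff_monom_mult[of "Poly_Mapping.single i 3" 1 g m] unfolding Var_power
      by (simp add: mult.commute del: single_numeral)
    with m k have "Poly_Mapping.single i 3 + m \<in> M" by (auto simp: in_keys_iff)
    then show ?thesis
      unfolding M_def by (auto simp: lookup_add lookup_single when_def simp del: single_numeral)
  qed
  have "\<exists>i j n. m = Poly_Mapping.single i 2 + Poly_Mapping.single j 2 + n"
  proof (cases "\<exists>i. 4 \<le> Poly_Mapping.lookup m i")
    case True
    then obtain i where "4 \<le> Poly_Mapping.lookup m i" by blast
    then have "m = Poly_Mapping.single i 2 + Poly_Mapping.single i 2 +
        (m - (Poly_Mapping.single i 2 + Poly_Mapping.single i 2))"
      by (intro poly_mapping_eqI)
        (auto simp: lookup_add lookup_minus lookup_single when_def simp del: single_numeral)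
    then show ?thesis by blast
  next
    case False
    \<comment> \<open>Using \<open>le\<close> once gives a variable with exponent at least 2; using
      it again at that variable gives a second, different one.\<close>
    with le obtain i where i: "2 \<le> Poly_Mapping.lookup m i" by metis
    with le[of i] False obtain j where "j \<noteq> i" "2 \<le> Poly_Mapping.lookup m j" by auto
    with i have "m = Poly_Mapping.single i 2 + Poly_Mapping.single j 2 +
        (m - (Poly_Mapping.single i 2 + Poly_Mapping.single j 2))"
      by (intro poly_mapping_eqI)
        (auto simp: lookup_add lookup_minus lookup_single when_def simp del: single_numeral)
    then show ?thesis by blast
  qed
  then obtain i j n where m: "m = Poly_Mapping.single i 2 + Poly_Mapping.single j 2 + n" by blast
  have eq: "pmonom m 1 = pmonom n 1 * (Var i ^ 2 * Var j ^ 2)"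
    unfolding Var_power m by (simp add: mult_single add_ac del: single_numeral)
  show "pmonom m 1 \<in> P.span square_products"
    unfolding eq by (rule mult_in_span) blast
qed

lemma square_products_quartics:
  obtains m where "m \<in> set quartics" "Var i ^ 2 * Var j ^ 2 = pmonom (xp m) (1 :: 'k::field)"
proof -
  have "\<exists>m\<in>set quartics. Poly_Mapping.single i 2 + Poly_Mapping.single j 2 = xp m"
  proof -
    have "\<forall>i j. \<exists>m\<in>set quartics. Poly_Mapping.single i 2 + Poly_Mapping.single j 2 = xp m"
      unfolding forall_4 by (simp add: quartics_def expo_eq_iff lookup_add lookup_single del: single_numeral)
    then show ?thesis by blast
  qed
  with that show ?thesis by (auto simp: Var_power mult_single simp del: single_numeral)
qed

lemma frobenius_add:
  assumes "(3::'a::comm_ring_1) = 0"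
  shows "(a + b) ^ (3 ^ e) = a ^ (3 ^ e) + (b::'a) ^ (3 ^ e)"
proof (induction e)
  case (Suc e)
  have "(a + b) ^ (3 ^ Suc e) = ((a + b) ^ (3 ^ e)) ^ 3" by (simp add: power_mult[symmetric] mult.commute)
  also have "\<dots> = (a ^ (3 ^ e)) ^ 3 + (b ^ (3 ^ e)) ^ 3" unfolding Suc by (rule cube_add[OF assms])
  finally show ?case by (simp add: power_mult[symmetric] mult.commute)
qed simp

text \<open>Since \<open>x\<^sub>i\<^sup>9 = x\<^sub>i\<^sup>2 x\<^sub>i\<^sup>7\<close> and \<open>7 \<ge> 6\<close>, already the Frobenius closure contains \<open>x\<^sub>i\<^sup>3\<close>.\<close>

lemma cube_frobenius_closure:
  assumes ch: "CHAR('k::field) = 3" and "e \<ge> 1"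
  shows "(Var i ^ 3) ^ (3 ^ e) \<in> P.span (insert (hypf :: 'k poly4) {(Var j ^ 2) ^ (3 ^ e) | j. j \<noteq> i})"
    (is "_ \<in> P.span ?G")
proof -
  \<comment> \<open>One factor 3 of \<open>q\<close> is split off, so that \<open>(x_i^3)^q\<close>
    has exponent \<open>9 * 3^d = 2 * 3^d + 7 * 3^d\<close> and the \<open>3^d\<close>-th power of
    \<open>hypf\<close> rewrites the second part.\<close>
  obtain d where e: "e = Suc d" using \<open>e \<ge> 1\<close> by (cases e) auto
  let ?k = "3 ^ d :: nat"
  note three = char3_poly4[OF ch]
  have sum: "(\<Sum>x\<in>A. f x) ^ ?k = (\<Sum>x\<in>A. f x ^ ?k)" if "finite A" for A and f :: "4 \<Rightarrow> 'k poly4"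
    using that by (induction A) (simp_all add: frobenius_add[OF three])
  have "hypf ^ ?k = (\<Sum>i\<in>UNIV. (Var i ^ 7) ^ ?k :: 'k poly4)"
    unfolding hypf_def by (rule sum) simp
  also have "\<dots> = (Var i ^ 7) ^ ?k + (\<Sum>j\<in>UNIV - {i}. (Var j ^ 7) ^ ?k)"
    by (subst sum.remove[of _ i]) auto
  finally have eq: "(Var i ^ 7) ^ ?k = hypf ^ ?k - (\<Sum>j\<in>UNIV - {i}. (Var j ^ 7) ^ ?k :: 'k poly4)" by simp
  have "hypf ^ ?k \<in> P.span ?G"
  proof -
    have eq: "hypf ^ ?k = hypf ^ (?k - 1) * (hypf :: 'k poly4)" by (rule power_minus_mult[symmetric]) simp
    show ?thesis unfolding eq by (rule mult_in_span) simp
  qed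
  moreover have "(Var j ^ 7) ^ ?k \<in> P.span ?G" if "j \<noteq> i" for j
  proof -
    have "7 * ?k = ?k + 2 * 3 ^ e" by (simp add: e)
    then have eq: "(Var j ^ 7) ^ ?k = Var j ^ ?k * (Var j ^ 2) ^ (3 ^ e)"
      unfolding power_mult[symmetric] power_add[symmetric] by (rule arg_cong)
    show ?thesis unfolding eq by (rule mult_in_span) (use that in blast)
  qed
  ultimately have "(Var i ^ 7) ^ ?k \<in> P.span ?G"
    unfolding eq by (intro P.span_diff P.span_sum) auto
  then have *: "Var i ^ (2 * ?k) * (Var i ^ 7) ^ ?k \<in> P.span ?G"
    by (rule P.span_scale)
  have "3 * 3 ^ e = 2 * ?k + 7 * ?k" by (simp add: e)
  then have eq: "(Var i ^ 3) ^ (3 ^ e) = Var i ^ (2 * ?k) * (Var i ^ 7) ^ ?k"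
    unfolding power_mult[symmetric] power_add[symmetric] by (rule arg_cong)
  show ?thesis unfolding eq by (rule *)
qed

subsection \<open>Multipliers\<close>

text \<open>Bracket powers are computed in the polynomial ring; adjoining \<open>hypf\<close> makes
  this a preimage from the quotient ring.\<close>

definition bracket :: "'k::field poly4 set \<Rightarrow> nat \<Rightarrow> 'k poly4 set" where
  "bracket W q = P.span (insert hypf {w ^ q | w. w \<in> W})"

text \<open>A generator \<open>w ^ (3 * q)\<close> is a cube and comes out as \<open>w ^ q\<close>,
  while multiples of \<open>hypf\<close> stay multiples by \<open>ctr_hypf_cube\<close>.\<close>

lemma ctr_bracket:
  fixes W :: "'k::field poly4 set"
  assumes ch: "CHAR('k) = 3" and l: "semilin l" "\<forall>i. Poly_Mapping.lookup r i \<le> 2"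
    and g: "g \<in> bracket W (3 * q)"
  shows "ctr l r (hypf ^ 2 * g) \<in> bracket W q"
  using g unfolding bracket_def
proof (induction g rule: P.span_induct_alt)
  case base
  have "ctr l r 0 = 0" using semilin_0[OF l(1)] by (intro poly_mapping_eqI) (simp add: coeff_ctr[OF l(1)])
  then show ?case by (simp add: P.span_zero)
next
  case (step c x y)
  have "ctr l r (hypf ^ 2 * (c * x)) \<in> P.span (insert hypf {w ^ q | w. w \<in> W})"
  proof (cases "x = hypf")
    case True
    then have "hypf ^ 2 * (c * x) = hypf ^ 2 * (hypf * c)" by (simp add: mult_ac)
    then have "ctr l r (hypf ^ 2 * (c * x)) = ctr l r c * hypf"
      using ctr_hypf_cube[OF l ch, of c] by (simp only: mult.commute[of hypf "ctr l r c"])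
    then show ?thesis by (simp only:) (rule mult_in_span, simp)
  next
    case False
    then obtain w where w: "w \<in> W" "x = w ^ (3 * q)" using step(1) by blast
    have "hypf ^ 2 * (c * x) = (w ^ q) ^ 3 * (hypf ^ 2 * c)"
      unfolding w by (simp add: power_mult[symmetric] mult_ac)
    then have "ctr l r (hypf ^ 2 * (c * x)) = ctr l r (hypf ^ 2 * c) * w ^ q"
      using ctr_cube_mult[OF l ch, of "w ^ q" "hypf ^ 2 * c"] by (simp only: mult.commute[of "w ^ q"])
    then show ?thesis by (simp only:) (rule mult_in_span, use w(1) in blast)
  qed
  with step show ?case by (simp add: distrib_left ctr_add[OF l(1)] P.span_add)
qed

text \<open>These polynomials become invertible in the local ring at the origin; most are not units
  of the polynomial ring.\<close>

abbreviation units :: "'k::field poly4 set" where "units \<equiv> {s. pcoeff s 0 \<noteq> 0}"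

lemma coeff_mult_0: "pcoeff (g * h) 0 = pcoeff g 0 * pcoeff h (0 :: 4 \<Rightarrow>\<^sub>0 nat)"
proof (induction g rule: poly4_induct)
  case (pmonom m c)
  show ?case
  proof (cases "m = 0")
    case True
    then show ?thesis using coeff_monom_mult[of 0 c h 0] by simp
  next
    case False
    have "0 \<noteq> m + k" for k using False by (auto simp: expo_eq_iff lookup_add)
    then show ?thesis using False by (simp add: coeff_monom_mult_0 lookup_single)
  qed
qed (simp add: distrib_right lookup_add)

text \<open>With \<open>a\<close> the numerator of \<open>u\<close> and \<open>W\<close> the
  contraction of \<open>I\<close>, these are the \<open>t\<close> with \<open>t u^q\<close> in the
  bracket power for all \<open>q\<close> from the threshold on. The factor \<open>v\<close> clears
  denominators and may depend on \<open>e\<close>.\<close>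

definition multipliers :: "'k::field poly4 set \<Rightarrow> 'k poly4 \<Rightarrow> nat \<Rightarrow> 'k poly4 set" where
  "multipliers W a e\<^sub>0 = {t. \<forall>e\<ge>e\<^sub>0. \<exists>v\<in>units. v * t * a ^ (3 ^ e) \<in> bracket W (3 ^ e)}"

lemma multipliers_Suc:
  fixes W :: "'k::field poly4 set"
  assumes ch: "CHAR('k) = 3"
  shows "trace_maps (multipliers W a (Suc e\<^sub>0)) (multipliers W a e\<^sub>0)"
  unfolding trace_maps_def
proof (intro allI impI)
  fix l :: "'k \<Rightarrow> 'k" and r :: "4 \<Rightarrow>\<^sub>0 nat" and t
  assume l: "semilin l" "\<forall>i. Poly_Mapping.lookup r i \<le> 2" and t: "t \<in> multipliers W a (Suc e\<^sub>0)"
  show "ctr l r (hypf ^ 2 * t) \<in> multipliers W a e\<^sub>0"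
    unfolding multipliers_def
  proof (intro CollectI allI impI)
    fix e assume "e\<^sub>0 \<le> e"
    then have "Suc e\<^sub>0 \<le> Suc e" by simp
    with t obtain v where v: "v \<in> units" "v * t * a ^ (3 ^ Suc e) \<in> bracket W (3 ^ Suc e)"
      unfolding multipliers_def by blast
    \<comment> \<open>The extra \<open>v ^ 2\<close> turns \<open>v\<close> into a cube, which can
      be moved out of the trace map as \<open>v\<close>.\<close>
    have "v ^ 2 * (v * t * a ^ (3 ^ Suc e)) \<in> bracket W (3 * 3 ^ e)"
      using v(2) unfolding bracket_def power_Suc by (rule P.span_scale)
    from ctr_bracket[OF ch l this]
    have "ctr l r (hypf ^ 2 * (v ^ 2 * (v * t * a ^ (3 ^ Suc e)))) \<in> bracket W (3 ^ e)" .
    moreover have "hypf ^ 2 * (v ^ 2 * (v * t * a ^ (3 ^ Suc e))) = (v * a ^ (3 ^ e)) ^ 3 * (hypf ^ 2 * t)"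
    proof -
      have "a ^ (3 ^ Suc e) = (a ^ (3 ^ e)) ^ 3" by (simp add: power_mult[symmetric] mult.commute)
      then show ?thesis by (simp add: power2_eq_square power3_eq_cube mult_ac)
    qed
    ultimately have "v * a ^ (3 ^ e) * ctr l r (hypf ^ 2 * t) \<in> bracket W (3 ^ e)"
      by (simp only: ctr_cube_mult[OF l ch])
    with v(1) show "\<exists>v\<in>units. v * ctr l r (hypf ^ 2 * t) * a ^ (3 ^ e) \<in> bracket W (3 ^ e)"
      by (intro bexI[of _ v]) (simp_all add: mult_ac)
  qed
qed

lemma multipliers_mono: "multipliers W a e\<^sub>0 \<subseteq> multipliers W a (Suc e\<^sub>0)"
  unfolding multipliers_def by auto

lemma subspace_multipliers: "P.subspace (multipliers W a e\<^sub>0)"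
proof (rule P.subspaceI)
  show "0 \<in> multipliers W a e\<^sub>0"
    unfolding multipliers_def bracket_def by (auto simp: P.span_zero intro: exI[of _ 1])
next
  fix x y assume xy: "x \<in> multipliers W a e\<^sub>0" "y \<in> multipliers W a e\<^sub>0"
  show "x + y \<in> multipliers W a e\<^sub>0" unfolding multipliers_def
  proof (intro CollectI allI impI)
    fix e assume e: "e\<^sub>0 \<le> e"
    from xy e obtain v w where v: "v \<in> units" "w \<in> units"
      "v * x * a ^ (3 ^ e) \<in> bracket W (3 ^ e)" "w * y * a ^ (3 ^ e) \<in> bracket W (3 ^ e)"
      unfolding multipliers_def by blast
    have "w * (v * x * a ^ (3 ^ e)) + v * (w * y * a ^ (3 ^ e)) \<in> bracket W (3 ^ e)"
      using v(3,4) unfolding bracket_def by (rule P.span_add[OF P.span_scale P.span_scale])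
    then have "(v * w) * (x + y) * a ^ (3 ^ e) \<in> bracket W (3 ^ e)" by (simp add: algebra_simps)
    moreover have "v * w \<in> units" using v by (simp add: coeff_mult_0)
    ultimately show "\<exists>v\<in>units. v * (x + y) * a ^ (3 ^ e) \<in> bracket W (3 ^ e)" by blast
  qed
next
  fix c x assume x: "x \<in> multipliers W a e\<^sub>0"
  show "c * x \<in> multipliers W a e\<^sub>0" unfolding multipliers_def
  proof (intro CollectI allI impI)
    fix e assume e: "e\<^sub>0 \<le> e"
    from x e obtain v where v: "v \<in> units" "v * x * a ^ (3 ^ e) \<in> bracket W (3 ^ e)"
      unfolding multipliers_def by blast
    have "c * (v * x * a ^ (3 ^ e)) \<in> bracket W (3 ^ e)"
      using v(2) unfolding bracket_def by (rule P.span_scale)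
    with v(1) show "\<exists>v\<in>units. v * (c * x) * a ^ (3 ^ e) \<in> bracket W (3 ^ e)"
      by (intro bexI[of _ v]) (simp_all add: mult_ac)
  qed
qed

text \<open>A smaller threshold is the stronger condition, so maps that lower it preserve each set
  of multipliers.\<close>

lemma stable_multipliers:
  fixes W :: "'k::field poly4 set"
  assumes ch: "CHAR('k) = 3"
  shows "stable (multipliers W a e\<^sub>0)"
  unfolding stable_def
proof (intro conjI)
  show "hypf \<in> multipliers W a e\<^sub>0"
    unfolding multipliers_def
  proof (intro CollectI allI impI bexI[of _ 1])
    fix e
    have "a ^ 3 ^ e * hypf \<in> bracket W (3 ^ e)"
      unfolding bracket_def by (rule mult_in_span) simp
    then show "1 * hypf * a ^ 3 ^ e \<in> bracket W (3 ^ e)" by (simp add: mult.commute)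
  qed simp
  show "trace_maps (multipliers W a e\<^sub>0) (multipliers W a e\<^sub>0)"
    using multipliers_Suc[OF ch, of W a e\<^sub>0] multipliers_mono[of W a e\<^sub>0] unfolding trace_maps_def by blast
qed (rule subspace_multipliers)

text \<open>The generators are first obtained at the given threshold and then carried down to 0 by
  one trace map per unit. The test ideal needs threshold 0, as it concerns all \<open>q\<close>
  including 1.\<close>

lemma square_products_multipliers:
  fixes W :: "'k::field poly4 set"
  assumes ch: "CHAR('k) = 3" and b: "b \<in> multipliers W a e\<^sub>0" "\<not> hypf dvd b"
  shows "Var i ^ 2 * Var j ^ 2 \<in> multipliers W a 0"
proof -
  have "achieves (multipliers W a (e\<^sub>0 - d)) {m} m" if "m \<in> set quartics" for m d
    using that
  proof (induction d arbitrary: m)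
    case 0
    then show ?case using stable_achieves_quartics[OF stable_multipliers[OF ch] ch b] by simp
  next
    case (Suc d)
    show ?case
    proof (cases "e\<^sub>0 - d = 0")
      case True
      with Suc show ?thesis by (metis diff_0_eq_0 diff_Suc)
    next
      case False
      then have "e\<^sub>0 - d = Suc (e\<^sub>0 - Suc d)" by simp
      then show ?thesis
        using achieves_quartics_descend[OF multipliers_Suc[OF ch] ch, of W a "e\<^sub>0 - Suc d" m] Suc by metis
    qed
  qed
  from this[of _ e\<^sub>0] have "achieves (multipliers W a 0) {m} m" if "m \<in> set quartics" for m
    using that by simp
  from achieves_singleD[OF subspace_multipliers this]
  have "pmonom (xp m) 1 \<in> multipliers W a 0" if "m \<in> set quartics" for m using that .
  then show ?thesis using square_products_quartics[of i j] by metis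
qed

subsection \<open>The ring of the hypersurface\<close>

lemma poly_ring4_simps [simp]:
  "carrier poly_ring4 = UNIV" "x \<otimes>\<^bsub>poly_ring4\<^esub> y = x * y" "x \<oplus>\<^bsub>poly_ring4\<^esub> y = x + y"
  "\<one>\<^bsub>poly_ring4\<^esub> = 1" "\<zero>\<^bsub>poly_ring4\<^esub> = 0"
  by (simp_all add: poly_ring4_def ring_of_type_algebra_def)

lemma cring_poly_ring4: "cring poly_ring4"
  unfolding poly_ring4_def by (rule cring_from_type_algebra)

lemma hyp_ideal_eq: "hyp_ideal = {g :: 'k::field poly4. hypf dvd g}"
proof -
  interpret cring "poly_ring4 :: 'k poly4 ring" by (rule cring_poly_ring4)
  have "hyp_ideal = PIdl\<^bsub>poly_ring4\<^esub> (hypf :: 'k poly4)"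
    unfolding hyp_ideal_def hypf_def by (rule cgenideal_eq_genideal[symmetric]) simp
  then show ?thesis unfolding cgenideal_def dvd_def by (auto simp: mult.commute)
qed

lemma ideal_hyp_ideal: "ideal hyp_ideal (poly_ring4 :: 'k::field poly4 ring)"
proof -
  interpret cring "poly_ring4 :: 'k poly4 ring" by (rule cring_poly_ring4)
  show ?thesis unfolding hyp_ideal_def by (rule genideal_ideal) simp
qed

definition cls :: "'k::field poly4 \<Rightarrow> 'k poly4 set" where
  "cls g = hyp_ideal +>\<^bsub>poly_ring4\<^esub> g"

lemma hyp_var_eq: "hyp_var i = cls (Var i)"
  by (simp add: hyp_var_def cls_def)

lemma cring_hyp_ring: "cring (hyp_ring :: 'k::field poly4 set ring)"
  unfolding hyp_ring_def by (rule ideal.quotient_is_cring[OF ideal_hyp_ideal cring_poly_ring4])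

lemma ring_hom_cls: "ring_hom_cring poly_ring4 hyp_ring (cls :: 'k::field poly4 \<Rightarrow> _)"
proof -
  have eq: "(cls :: 'k poly4 \<Rightarrow> _) = (+>\<^bsub>poly_ring4\<^esub>) hyp_ideal"
    by (rule ext) (simp add: cls_def)
  show ?thesis
    unfolding hyp_ring_def eq
    by (rule ideal.rcos_ring_hom_cring[OF ideal_hyp_ideal cring_poly_ring4])
qed

lemma cls_simps:
  "cls g \<otimes>\<^bsub>hyp_ring\<^esub> cls h = cls (g * h)" "cls g \<oplus>\<^bsub>hyp_ring\<^esub> cls h = cls (g + h)"
  "\<one>\<^bsub>hyp_ring\<^esub> = cls (1 :: 'k poly4)" "\<zero>\<^bsub>hyp_ring\<^esub> = cls (0 :: 'k poly4)"
  for g h :: "'k::field poly4"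
proof -
  interpret ring_hom_cring "poly_ring4 :: 'k poly4 ring" hyp_ring cls by (rule ring_hom_cls)
  show "cls g \<otimes>\<^bsub>hyp_ring\<^esub> cls h = cls (g * h)" "cls g \<oplus>\<^bsub>hyp_ring\<^esub> cls h = cls (g + h)"
    using hom_mult[of g h] hom_add[of g h] by simp_all
  show "\<one>\<^bsub>hyp_ring\<^esub> = cls (1 :: 'k poly4)" "\<zero>\<^bsub>hyp_ring\<^esub> = cls (0 :: 'k poly4)"
    using hom_one hom_zero by simp_all
qed

lemma cls_eq_iff: "cls g = cls h \<longleftrightarrow> hypf dvd g - (h :: 'k::field poly4)"
proof -
  have *: "x \<in> cls h \<longleftrightarrow> hypf dvd x - h" for x h :: "'k poly4"
    unfolding cls_def a_r_coset_def' hyp_ideal_eq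
    by (auto simp: dvd_def) (metis add.commute diff_add_cancel)
  show ?thesis
  proof
    assume "cls g = cls h"
    moreover have "g \<in> cls g" by (simp add: *)
    ultimately show "hypf dvd g - h" by (simp add: *)
  next
    assume gh: "hypf dvd g - h"
    have "hypf dvd x - g \<longleftrightarrow> hypf dvd x - h" for x
      using dvd_add[OF _ gh, of "x - g"] dvd_diff[OF _ gh, of "x - h"] by auto
    then show "cls g = cls h" using * by blast
  qed
qed

lemma carrier_hyp_ring: "carrier hyp_ring = range (cls :: 'k::field poly4 \<Rightarrow> _)"
  unfolding hyp_ring_def FactRing_simps cls_def by auto

lemma cls_carrier [simp]: "cls g \<in> carrier hyp_ring"
  by (simp add: carrier_hyp_ring)

lemma coeff_hypf_0: "hypf dvd (g :: 'k::field poly4) \<Longrightarrow> pcoeff g 0 = 0"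
proof (elim dvdE)
  fix w assume "g = hypf * w"
  moreover have "E i \<noteq> 0" for i :: 4 by (metis lookup_single_eq lookup_zero zero_neq_numeral)
  then have "pcoeff (hypf :: 'k poly4) 0 = 0" unfolding hypf_eq lookup_sum by (simp add: lookup_single_not_eq del: single_numeral)
  ultimately show "pcoeff g 0 = 0" by (simp add: coeff_mult_0)
qed

text \<open>A monomial other than 1 is divisible by some variable, and the polynomials without
  constant term form an ideal.\<close>

lemma hyp_max_eq: "hyp_max = cls ` {g :: 'k::field poly4. pcoeff g 0 = 0}" (is "_ = ?M")
proof -
  interpret cring "hyp_ring :: 'k poly4 set ring" by (rule cring_hyp_ring)
  have minus: "\<ominus>\<^bsub>hyp_ring\<^esub> cls g = cls (- g)" for g :: "'k poly4"
    by (rule minus_equality) (simp_all add: cls_simps)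
  have M: "ideal ?M hyp_ring"
  proof (rule idealI)
    show "subgroup ?M (add_monoid hyp_ring)"
    proof (rule add.subgroupI)
      show "\<ominus>\<^bsub>hyp_ring\<^esub> a \<in> ?M" if "a \<in> ?M" for a
        using that by (auto simp: minus)
      show "a \<oplus>\<^bsub>hyp_ring\<^esub> b \<in> ?M" if "a \<in> ?M" "b \<in> ?M" for a b
        using that by (auto simp: cls_simps lookup_add)
    qed (auto intro: exI[of _ 0])
  next
    fix a x :: "'k poly4 set" assume "a \<in> ?M" "x \<in> carrier hyp_ring"
    then obtain g h where gh: "a = cls g" "pcoeff g 0 = 0" "x = cls h" by (auto simp: carrier_hyp_ring)
    then show "x \<otimes>\<^bsub>hyp_ring\<^esub> a \<in> ?M" "a \<otimes>\<^bsub>hyp_ring\<^esub> x \<in> ?M"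
      by (auto simp: cls_simps coeff_mult_0)
  qed (rule ring_axioms)
  have "pcoeff (Var i :: 'k poly4) 0 = 0" for i
  proof -
    have "Poly_Mapping.single i (1::nat) \<noteq> 0" by (metis lookup_single_eq lookup_zero zero_neq_one)
    then show ?thesis unfolding Var_def by (rule lookup_single_not_eq)
  qed
  then have "range hyp_var \<subseteq> ?M"
    unfolding hyp_var_eq by blast
  then have "hyp_max \<subseteq> ?M"
    unfolding hyp_max_def by (rule genideal_minimal[OF M])
  moreover have "?M \<subseteq> hyp_max"
  proof -
    have ran: "range hyp_var \<subseteq> carrier (hyp_ring :: 'k poly4 set ring)" by (auto simp: hyp_var_eq)
    interpret I: ideal hyp_max "hyp_ring :: 'k poly4 set ring"
      unfolding hyp_max_def by (rule genideal_ideal[OF ran])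
    have T: "P.subspace {g :: 'k poly4. cls g \<in> hyp_max}"
    proof (rule P.subspaceI)
      show "0 \<in> {g :: 'k poly4. cls g \<in> hyp_max}" using I.zero_closed by (simp add: cls_simps)
    next
      fix x y :: "'k poly4" assume "x \<in> {g. cls g \<in> hyp_max}" "y \<in> {g. cls g \<in> hyp_max}"
      then show "x + y \<in> {g. cls g \<in> hyp_max}" using I.a_closed[of "cls x" "cls y"] by (simp add: cls_simps)
    next
      fix c x :: "'k poly4" assume "x \<in> {g. cls g \<in> hyp_max}"
      then show "c * x \<in> {g. cls g \<in> hyp_max}" using I.I_l_closed[of "cls x" "cls c"] by (simp add: cls_simps)
    qed
    have "g \<in> {g. cls g \<in> hyp_max}" if g: "pcoeff g 0 = 0" for g :: "'k poly4"
    proof (rule subspace_of_monoms[OF T])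
      fix m assume m: "m \<in> Poly_Mapping.keys g"
      with g have "m \<noteq> 0" by (auto simp: in_keys_iff)
      then obtain i where i: "Poly_Mapping.lookup m i \<noteq> 0" by (metis poly_mapping_eqI lookup_zero)
      then have "m = Poly_Mapping.single i 1 + (m - Poly_Mapping.single i 1)"
        by (intro poly_mapping_eqI) (auto simp: lookup_add lookup_minus lookup_single when_def)
      then have eq: "pmonom m 1 = pmonom (m - Poly_Mapping.single i 1) 1 * Var i"
        unfolding Var_def by (metis add.commute mult_single mult_1)
      have "hyp_var i \<in> (hyp_max :: 'k poly4 set set)"
        unfolding hyp_max_def by (rule subsetD[OF genideal_self[OF ran]]) (rule rangeI)
      then have "(Var i :: 'k poly4) \<in> {g. cls g \<in> hyp_max}" by (simp add: hyp_var_eq)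
      from P.subspace_scale[OF T this] show "(pmonom m 1 :: 'k poly4) \<in> {g. cls g \<in> hyp_max}" unfolding eq .
    qed
    then show ?thesis by auto
  qed
  ultimately show ?thesis by blast
qed

abbreviation denominators :: "'k::field poly4 set set" where
  "denominators \<equiv> carrier hyp_ring - hyp_max"

text \<open>The constant term is well defined on classes because multiples of \<open>hypf\<close>
  have none.\<close>

lemma denominators_eq: "denominators = cls ` (units :: 'k::field poly4 set)"
proof -
  have "pcoeff g 0 = pcoeff h 0" if "cls g = cls h" for g h :: "'k poly4"
    using coeff_hypf_0[of "g - h"] that by (simp add: cls_eq_iff lookup_minus)
  note const = this
  show ?thesis
  proof (intro equalityI subsetI)
    fix x :: "'k poly4 set" assume x: "x \<in> denominators"
    then obtain g where g: "x = cls g" unfolding carrier_hyp_ring by blast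
    with x have "pcoeff g 0 \<noteq> 0" unfolding hyp_max_eq by blast
    then show "x \<in> cls ` units" unfolding g by blast
  next
    fix x :: "'k poly4 set" assume "x \<in> cls ` units"
    then obtain g where g: "x = cls g" "pcoeff g 0 \<noteq> 0" by blast
    have "x \<notin> hyp_max"
    proof
      assume "x \<in> hyp_max"
      then obtain h where "x = cls h" "pcoeff h 0 = 0" unfolding hyp_max_eq by blast
      with g const[of g h] show False by simp
    qed
    then show "x \<in> denominators" unfolding g by simp
  qed
qed

lemma loc_data_hyp: "loc_data hyp_ring (denominators :: 'k::field poly4 set set)"
proof -
  interpret cring "hyp_ring :: 'k poly4 set ring" by (rule cring_hyp_ring)
  show ?thesis
  proof
    show "\<one>\<^bsub>hyp_ring\<^esub> \<in> (denominators :: 'k poly4 set set)"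
      unfolding denominators_eq cls_simps by (rule imageI) simp
    show "s \<otimes>\<^bsub>hyp_ring\<^esub> t \<in> denominators" if "s \<in> denominators" "t \<in> denominators" for s t :: "'k poly4 set"
      using that unfolding denominators_eq by (auto simp: cls_simps coeff_mult_0)
  qed auto
qed

subsection \<open>The local ring\<close>

definition fr :: "'k::field poly4 \<Rightarrow> 'k poly4 \<Rightarrow> ('k poly4 set \<times> 'k poly4 set) set" where
  "fr g s = loc_frac hyp_ring denominators (cls g) (cls s)"

lemma hyp_local_eq: "hyp_local = localization hyp_ring denominators"
  by (simp add: hyp_local_def localization_at_def)

lemma cring_hyp_local: "cring hyp_local"
  unfolding hyp_local_eq by (rule loc_data.cring_localization[OF loc_data_hyp])

lemma units_mult: "s \<in> units \<Longrightarrow> t \<in> units \<Longrightarrow> s * t \<in> units"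
  by (simp add: coeff_mult_0)

lemma units_one: "1 \<in> units" by simp

lemma units_power: "s \<in> units \<Longrightarrow> s ^ n \<in> units"
  by (induction n) (simp_all add: coeff_mult_0)

lemma cls_denom: "s \<in> units \<Longrightarrow> cls s \<in> denominators"
  unfolding denominators_eq by (rule imageI)

lemma fr_carrier: "s \<in> units \<Longrightarrow> fr g s \<in> carrier hyp_local"
  unfolding hyp_local_eq fr_def by (rule loc_data.loc_frac_carrier[OF loc_data_hyp]) (simp_all only: cls_carrier cls_denom)

lemma fr_cases:
  assumes "x \<in> carrier hyp_local"
  obtains g s where "x = fr g s" "s \<in> (units :: 'k::field poly4 set)"
proof -
  from assms obtain a t where at: "x = loc_frac hyp_ring denominators a t" "a \<in> carrier hyp_ring"
    "t \<in> (denominators :: 'k poly4 set set)"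
    unfolding hyp_local_eq by (rule loc_data.loc_carrierE[OF loc_data_hyp])
  from at(2) obtain g where "a = cls g" unfolding carrier_hyp_ring by blast
  moreover from at(3) obtain s where "t = cls s" "s \<in> units" unfolding denominators_eq by blast
  ultimately show ?thesis using that at(1) unfolding fr_def by blast
qed

lemma fr_mult: "s \<in> units \<Longrightarrow> t \<in> units \<Longrightarrow> fr g s \<otimes>\<^bsub>hyp_local\<^esub> fr h t = fr (g * h) (s * t)"
  unfolding hyp_local_eq fr_def
  by (subst loc_data.loc_mult[OF loc_data_hyp]) (simp_all only: cls_carrier cls_denom cls_simps)

lemma fr_add: "s \<in> units \<Longrightarrow> t \<in> units \<Longrightarrow> fr g s \<oplus>\<^bsub>hyp_local\<^esub> fr h t = fr (g * t + h * s) (s * t)"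
  unfolding hyp_local_eq fr_def
  by (subst loc_data.loc_add[OF loc_data_hyp]) (simp_all only: cls_carrier cls_denom cls_simps)

lemma fr_one: "\<one>\<^bsub>hyp_local\<^esub> = fr 1 1" and fr_zero: "\<zero>\<^bsub>hyp_local\<^esub> = fr 0 1"
  unfolding hyp_local_eq fr_def cls_simps[symmetric]
  by (rule loc_data.loc_one[OF loc_data_hyp] loc_data.loc_zero[OF loc_data_hyp])+

lemma fr_power: "s \<in> units \<Longrightarrow> fr g s [^]\<^bsub>hyp_local\<^esub> (n::nat) = fr (g ^ n) (s ^ n)"
proof (induction n)
  case 0
  then show ?case by (simp add: fr_one)
next
  case (Suc n)
  then show ?case using fr_mult[OF units_power[OF Suc.prems, of n] Suc.prems, of "g ^ n" g]
    by (simp add: mult.commute)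
qed

lemma local_var_eq: "local_var i = fr (Var i) 1"
  unfolding local_var_def fr_def hyp_var_eq cls_simps by simp

text \<open>The auxiliary factor from the localization cancels: \<open>hypf\<close> is prime and
  does not divide a polynomial with nonzero constant term.\<close>

lemma fr_eq_iff:
  fixes g h :: "'k::field poly4"
  assumes ch: "CHAR('k) = 3" and st: "s \<in> units" "t \<in> units"
  shows "fr g s = fr h t \<longleftrightarrow> hypf dvd g * t - h * s"
proof -
  have "fr g s = fr h t \<longleftrightarrow> (\<exists>v\<in>denominators. v \<otimes>\<^bsub>hyp_ring\<^esub> (cls g \<otimes>\<^bsub>hyp_ring\<^esub> cls t) =
      v \<otimes>\<^bsub>hyp_ring\<^esub> (cls h \<otimes>\<^bsub>hyp_ring\<^esub> cls s))"
    unfolding fr_def by (rule loc_data.loc_frac_eq_iff[OF loc_data_hyp cls_carrier cls_denom[OF st(1)] cls_carrier cls_denom[OF st(2)]])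
  also have "\<dots> \<longleftrightarrow> (\<exists>v\<in>units. hypf dvd v * (g * t) - v * (h * s))"
    unfolding denominators_eq cls_simps by (simp add: cls_simps cls_eq_iff)
  also have "\<dots> \<longleftrightarrow> hypf dvd g * t - h * s"
  proof
    assume "\<exists>v\<in>units. hypf dvd v * (g * t) - v * (h * s)"
    then obtain v where v: "v \<in> units" "hypf dvd v * (g * t - h * s)" by (auto simp: right_diff_distrib)
    from hypf_prime[OF ch v(2)] v(1) coeff_hypf_0[of v] show "hypf dvd g * t - h * s" by auto
  next
    assume "hypf dvd g * t - h * s"
    then show "\<exists>v\<in>units. hypf dvd v * (g * t) - v * (h * s)" by (intro bexI[of _ 1]) simp_all
  qed
  finally show ?thesis .
qed

lemma fr_cancel:
  fixes g :: "'k::field poly4"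
  assumes "CHAR('k) = 3" "s \<in> units" "v \<in> units"
  shows "fr g s = fr (v * g) (v * s)"
  using assms by (subst fr_eq_iff) (simp_all add: coeff_mult_0 mult_ac)

subsection \<open>Ideals of the local ring\<close>

text \<open>An ideal of the local ring is determined by its contraction to the polynomial ring, an
  ideal containing \<open>hypf\<close>.\<close>

lemma ideal_contraction:
  fixes I :: "('k::field poly4 set \<times> 'k poly4 set) set set"
  assumes ch: "CHAR('k) = 3" and I: "ideal I hyp_local"
  shows "P.subspace {g. fr g 1 \<in> I}" "hypf \<in> {g. fr g 1 \<in> I}"
    "s \<in> units \<Longrightarrow> fr g s \<in> I \<longleftrightarrow> fr g 1 \<in> I"
proof -
  interpret I: ideal I hyp_local by (rule I)
  note zero = additive_subgroup.zero_closed[OF ideal.axioms(1)[OF I]]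
  show "P.subspace {g. fr g 1 \<in> I}"
  proof (rule P.subspaceI)
    show "0 \<in> {g. fr g 1 \<in> I}" using zero by (simp add: fr_zero)
  next
    fix x y assume "x \<in> {g. fr g 1 \<in> I}" "y \<in> {g. fr g 1 \<in> I}"
    then show "x + y \<in> {g. fr g 1 \<in> I}"
      using additive_subgroup.a_closed[OF ideal.axioms(1)[OF I], of "fr x 1" "fr y 1"] by (simp add: fr_add)
  next
    fix c x assume "x \<in> {g. fr g 1 \<in> I}"
    then show "c * x \<in> {g. fr g 1 \<in> I}"
      using I.I_l_closed[of "fr x 1" "fr c 1"] by (simp add: fr_mult fr_carrier)
  qed
  have "fr hypf 1 = fr (0 :: 'k poly4) 1" using ch by (subst fr_eq_iff) simp_all
  then show "hypf \<in> {g. fr g 1 \<in> I}" using zero by (simp add: fr_zero)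
  show "fr g s \<in> I \<longleftrightarrow> fr g 1 \<in> I" if s: "s \<in> units"
  proof
    assume "fr g s \<in> I"
    then have "fr s 1 \<otimes>\<^bsub>hyp_local\<^esub> fr g s \<in> I" by (rule I.I_l_closed) (rule fr_carrier[OF units_one])
    then have "fr (s * g) (s * 1) \<in> I" using fr_mult[OF units_one s, of s g] by simp
    then show "fr g 1 \<in> I" using fr_cancel[OF ch units_one s, of g] by simp
  next
    assume "fr g 1 \<in> I"
    then have "fr 1 s \<otimes>\<^bsub>hyp_local\<^esub> fr g 1 \<in> I" by (rule I.I_l_closed) (rule fr_carrier[OF s])
    then show "fr g s \<in> I" using fr_mult[OF s units_one, of 1 g] by simp
  qed
qed

lemma span_contraction:
  fixes I :: "('k::field poly4 set \<times> 'k poly4 set) set set"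
  assumes ch: "CHAR('k) = 3" and I: "ideal I hyp_local" and W: "\<And>w. w \<in> W \<Longrightarrow> fr w 1 \<in> I"
    and g: "g \<in> P.span (insert hypf W)"
  shows "fr g 1 \<in> I"
proof -
  have "insert hypf W \<subseteq> {g. fr g 1 \<in> I}"
    using ideal_contraction(2)[OF ch I] W by blast
  then have "P.span (insert hypf W) \<subseteq> {g. fr g 1 \<in> I}"
    by (rule P.span_minimal[OF _ ideal_contraction(1)[OF ch I]])
  with g show ?thesis by blast
qed

definition extension :: "'k::field poly4 set \<Rightarrow> ('k poly4 set \<times> 'k poly4 set) set set" where
  "extension A = {fr g s | g s. g \<in> A \<and> s \<in> units}"

lemma fr_in_extension: "g \<in> A \<Longrightarrow> s \<in> units \<Longrightarrow> fr g s \<in> extension A"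
  unfolding extension_def by blast

lemma fr_extension_iff:
  fixes A :: "'k::field poly4 set"
  assumes ch: "CHAR('k) = 3" and A: "P.subspace A" "hypf \<in> A" and s: "s \<in> units"
  shows "fr g s \<in> extension A \<longleftrightarrow> (\<exists>v\<in>units. v * g \<in> A)"
proof
  assume "fr g s \<in> extension A"
  then obtain h t where h: "fr g s = fr h t" "h \<in> A" "t \<in> units" unfolding extension_def by blast
  then have "hypf dvd g * t - h * s" using fr_eq_iff[OF ch s] by blast
  then have "g * t - h * s \<in> A" by (rule subspace_hypf_multiple[OF A])
  moreover have "s * h \<in> A" by (rule P.subspace_scale[OF A(1) h(2)])
  ultimately have "(g * t - h * s) + s * h \<in> A" by (rule P.subspace_add[OF A(1)])
  then have "t * g \<in> A" by (simp add: mult.commute)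
  with h(3) show "\<exists>v\<in>units. v * g \<in> A" by blast
next
  assume "\<exists>v\<in>units. v * g \<in> A"
  then obtain v where v: "v \<in> units" "v * g \<in> A" by blast
  from fr_cancel[OF ch s v(1), of g] v units_mult[OF v(1) s] show "fr g s \<in> extension A"
    unfolding extension_def by blast
qed

lemma ideal_extension:
  fixes A :: "'k::field poly4 set"
  assumes ch: "CHAR('k) = 3" and A: "P.subspace A"
  shows "ideal (extension A) hyp_local"
proof -
  interpret cring "hyp_local :: ('k poly4 set \<times> 'k poly4 set) set ring" by (rule cring_hyp_local)
  note in_ext = fr_in_extension[of _ A]
  have minus: "\<ominus>\<^bsub>hyp_local\<^esub> fr g s = fr (- g) s" if s: "s \<in> units" for g s :: "'k poly4"
  proof (rule minus_equality)
    show "fr (- g) s \<oplus>\<^bsub>hyp_local\<^esub> fr g s = \<zero>\<^bsub>hyp_local\<^esub>"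
      unfolding fr_zero fr_add[OF s s] using s by (subst fr_eq_iff[OF ch]) (simp_all add: coeff_mult_0)
  qed (rule fr_carrier[OF s])+
  show ?thesis
  proof (rule idealI)
    show "subgroup (extension A) (add_monoid hyp_local)"
    proof (rule add.subgroupI)
      show "extension A \<subseteq> carrier hyp_local" unfolding extension_def using fr_carrier by auto
      show "extension A \<noteq> {}" using in_ext[OF P.subspace_0[OF A] units_one] by blast
      show "\<ominus>\<^bsub>hyp_local\<^esub> a \<in> extension A" if "a \<in> extension A" for a
      proof -
        from that obtain g s where g: "a = fr g s" "g \<in> A" "s \<in> units" unfolding extension_def by blast
        show ?thesis unfolding g(1) minus[OF g(3)] by (rule in_ext[OF P.subspace_neg[OF A g(2)] g(3)])
      qed
      show "a \<oplus>\<^bsub>hyp_local\<^esub> b \<in> extension A" if "a \<in> extension A" "b \<in> extension A" for a b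
      proof -
        from that obtain g s h t where g: "a = fr g s" "g \<in> A" "s \<in> units" "b = fr h t" "h \<in> A" "t \<in> units"
          unfolding extension_def by blast
        have "g * t + h * s \<in> A"
          using P.subspace_add[OF A P.subspace_scale[OF A g(2), of t] P.subspace_scale[OF A g(5), of s]]
          by (simp add: mult.commute)
        then show ?thesis unfolding g(1,4) fr_add[OF g(3,6)] by (rule in_ext[OF _ units_mult[OF g(3,6)]])
      qed
    qed
  next
    fix a x :: "('k poly4 set \<times> 'k poly4 set) set"
    assume "a \<in> extension A" "x \<in> carrier hyp_local"
    then obtain g s h t where g: "a = fr g s" "g \<in> A" "s \<in> units" "x = fr h t" "t \<in> units"
      unfolding extension_def by (blast elim: fr_cases)
    have "fr (h * g) (t * s) \<in> extension A"
      by (rule in_ext[OF P.subspace_scale[OF A g(2)] units_mult[OF g(5,3)]])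
    then show "x \<otimes>\<^bsub>hyp_local\<^esub> a \<in> extension A" "a \<otimes>\<^bsub>hyp_local\<^esub> x \<in> extension A"
      unfolding g(1,4) fr_mult[OF g(5,3)] fr_mult[OF g(3,5)] by (simp_all add: mult.commute)
  qed (rule ring_axioms)
qed

text \<open>Translates generated ideals of the local ring into ideals of the polynomial ring
  containing \<open>hypf\<close>.\<close>

lemma genideal_fr:
  fixes W :: "'k::field poly4 set"
  assumes ch: "CHAR('k) = 3"
  shows "Idl\<^bsub>hyp_local\<^esub> {fr w 1 | w. w \<in> W} = extension (P.span (insert hypf W))"
proof -
  interpret cring "hyp_local :: ('k poly4 set \<times> 'k poly4 set) set ring" by (rule cring_hyp_local)
  have sub: "{fr w 1 | w. w \<in> W} \<subseteq> carrier hyp_local" using fr_carrier[OF units_one] by auto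
  show ?thesis
  proof
    show "Idl\<^bsub>hyp_local\<^esub> {fr w 1 | w. w \<in> W} \<subseteq> extension (P.span (insert hypf W))"
    proof (rule genideal_minimal[OF ideal_extension[OF ch P.subspace_span]], rule subsetI)
      fix x assume "x \<in> {fr w 1 | w. w \<in> W}"
      then obtain w where w: "x = fr w 1" "w \<in> W" by blast
      show "x \<in> extension (P.span (insert hypf W))"
        unfolding w(1) by (rule fr_in_extension[OF P.span_base units_one]) (simp add: w(2))
    qed
    show "extension (P.span (insert hypf W)) \<subseteq> Idl\<^bsub>hyp_local\<^esub> {fr w 1 | w. w \<in> W}" (is "_ \<subseteq> ?I")
    proof
      fix x assume "x \<in> extension (P.span (insert hypf W))"
      then obtain g s where g: "x = fr g s" "g \<in> P.span (insert hypf W)" "s \<in> units"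
        unfolding extension_def by blast
      have I: "ideal ?I hyp_local" by (rule genideal_ideal[OF sub])
      have "fr g 1 \<in> ?I"
        by (rule span_contraction[OF ch I _ g(2)]) (use genideal_self[OF sub] in blast)
      then show "x \<in> ?I" using ideal_contraction(3)[OF ch I g(3)] g(1) by simp
    qed
  qed
qed

text \<open>The power of a fraction differs from that of its numerator by a unit, so powers of
  numerators generate.\<close>

lemma bracket_power_eq:
  fixes I :: "('k::field poly4 set \<times> 'k poly4 set) set set"
  assumes ch: "CHAR('k) = 3" and I: "ideal I hyp_local"
  shows "bracket_power hyp_local I q = extension (bracket {g. fr g 1 \<in> I} q)"
proof -
  interpret cring "hyp_local :: ('k poly4 set \<times> 'k poly4 set) set ring" by (rule cring_hyp_local)
  let ?W = "{w ^ q | w. w \<in> {g. fr g 1 \<in> I}}"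
  let ?P = "{u [^]\<^bsub>hyp_local\<^esub> q | u. u \<in> I}"
  have Ic: "I \<subseteq> carrier hyp_local" using I by (simp add: additive_subgroup.a_subset ideal.axioms(1))
  have Pc: "?P \<subseteq> carrier hyp_local" using Ic by auto
  have ext: "Idl\<^bsub>hyp_local\<^esub> {fr w 1 | w. w \<in> ?W} = extension (bracket {g. fr g 1 \<in> I} q)"
    unfolding bracket_def by (rule genideal_fr[OF ch])
  have "Idl\<^bsub>hyp_local\<^esub> ?P \<subseteq> extension (bracket {g. fr g 1 \<in> I} q)"
  proof (rule genideal_minimal)
    show "ideal (extension (bracket {g. fr g 1 \<in> I} q)) hyp_local"
      unfolding bracket_def by (rule ideal_extension[OF ch P.subspace_span])
    show "?P \<subseteq> extension (bracket {g. fr g 1 \<in> I} q)"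
    proof clarify
      fix u assume u: "u \<in> I"
      with Ic obtain g s where g: "u = fr g s" "s \<in> (units :: 'k poly4 set)" by (blast elim: fr_cases)
      with u have "fr g 1 \<in> I" using ideal_contraction(3)[OF ch I] by blast
      then have "g ^ q \<in> bracket {g. fr g 1 \<in> I} q" unfolding bracket_def by (intro P.span_base) blast
      then show "u [^]\<^bsub>hyp_local\<^esub> q \<in> extension (bracket {g. fr g 1 \<in> I} q)"
        unfolding g(1) fr_power[OF g(2)] extension_def using units_power[OF g(2)] by blast
    qed
  qed
  moreover have "Idl\<^bsub>hyp_local\<^esub> {fr w 1 | w. w \<in> ?W} \<subseteq> Idl\<^bsub>hyp_local\<^esub> ?P"
  proof (rule genideal_minimal[OF genideal_ideal[OF Pc]])
    have "{fr w 1 | w. w \<in> ?W} \<subseteq> ?P"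
    proof
      fix x assume "x \<in> {fr w 1 | w. w \<in> ?W}"
      then obtain w where w: "x = fr (w ^ q) 1" "fr w 1 \<in> I" by blast
      have "x = fr w 1 [^]\<^bsub>hyp_local\<^esub> q" unfolding w(1) fr_power[OF units_one] by simp
      with w(2) show "x \<in> ?P" by blast
    qed
    then show "{fr w 1 | w. w \<in> ?W} \<subseteq> Idl\<^bsub>hyp_local\<^esub> ?P" using genideal_self[OF Pc] by blast
  qed
  ultimately show ?thesis unfolding bracket_power_def ext by blast
qed

subsection \<open>The test ideal\<close>

text \<open>The local ring is a domain since \<open>hypf\<close> is prime. Hence an element outside
  all minimal primes is nonzero.\<close>

lemma minimal_prime_zero:
  assumes ch: "CHAR('k::field) = 3"
  shows "minimal_prime hyp_local {\<zero>\<^bsub>(hyp_local :: ('k poly4 set \<times> 'k poly4 set) set ring)\<^esub>}"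
proof -
  interpret cring "hyp_local :: ('k poly4 set \<times> 'k poly4 set) set ring" by (rule cring_hyp_local)
  have zero_iff: "fr g s = \<zero>\<^bsub>hyp_local\<^esub> \<longleftrightarrow> hypf dvd g" if "s \<in> units" for g s :: "'k poly4"
    unfolding fr_zero using that by (subst fr_eq_iff[OF ch]) simp_all
  have "primeideal {\<zero>\<^bsub>hyp_local\<^esub>} (hyp_local :: ('k poly4 set \<times> 'k poly4 set) set ring)"
  proof (rule primeidealI)
    have "\<not> hypf dvd (1 :: 'k poly4)" using coeff_hypf_0[of "1 :: 'k poly4"] by auto
    then have "fr 1 1 \<noteq> (\<zero>\<^bsub>hyp_local\<^esub> :: ('k poly4 set \<times> 'k poly4 set) set)"
      using zero_iff[OF units_one] by blast
    then show "carrier hyp_local \<noteq> {\<zero>\<^bsub>(hyp_local :: ('k poly4 set \<times> 'k poly4 set) set ring)\<^esub>}"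
      using fr_carrier[OF units_one, of 1] by blast
  next
    fix a b :: "('k poly4 set \<times> 'k poly4 set) set"
    assume "a \<in> carrier hyp_local" "b \<in> carrier hyp_local" and ab: "a \<otimes>\<^bsub>hyp_local\<^esub> b \<in> {\<zero>\<^bsub>hyp_local\<^esub>}"
    then obtain g s h t where g: "a = fr g s" "s \<in> units" "b = fr h t" "t \<in> units" by (metis fr_cases)
    with ab have "hypf dvd g * h" using zero_iff[OF units_mult[OF g(2,4)]] by (simp add: fr_mult)
    with hypf_prime[OF ch] have "hypf dvd g \<or> hypf dvd h" by blast
    then show "a \<in> {\<zero>\<^bsub>hyp_local\<^esub>} \<or> b \<in> {\<zero>\<^bsub>hyp_local\<^esub>}"
      using zero_iff[OF g(2)] zero_iff[OF g(4)] by (simp add: g(1,3))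
  qed (rule zeroideal cring_hyp_local)+
  moreover have "Q = {\<zero>\<^bsub>hyp_local\<^esub>}" if "primeideal Q hyp_local" "Q \<subseteq> {\<zero>\<^bsub>hyp_local\<^esub>}"
    for Q :: "('k poly4 set \<times> 'k poly4 set) set set"
  proof -
    have "\<zero>\<^bsub>hyp_local\<^esub> \<in> Q"
      using that(1) by (simp add: additive_subgroup.zero_closed ideal.axioms(1) primeideal.axioms(1))
    with that(2) show ?thesis by blast
  qed
  ultimately show ?thesis unfolding minimal_prime_def by blast
qed

text \<open>The numerator of the element witnessing tight closure is a multiplier from some
  threshold on and no multiple of \<open>hypf\<close>, so the generators are multipliers from
  threshold 0 on.\<close>

lemma square_products_in_test_ideal:
  assumes ch: "CHAR('k::field) = 3"
  shows "fr (Var i ^ 2 * Var j ^ 2) 1 \<in> test_ideal 3 (hyp_local :: ('k poly4 set \<times> 'k poly4 set) set ring)"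
proof -
  interpret cring "hyp_local :: ('k poly4 set \<times> 'k poly4 set) set ring" by (rule cring_hyp_local)
  let ?c = "Var i ^ 2 * Var j ^ 2 :: 'k poly4"
  have "fr ?c 1 \<otimes>\<^bsub>hyp_local\<^esub> u [^]\<^bsub>hyp_local\<^esub> ((3::nat) ^ e) \<in> bracket_power hyp_local I (3 ^ e)"
    if I: "ideal I hyp_local" and u: "u \<in> tight_closure 3 hyp_local I"
    for I :: "('k poly4 set \<times> 'k poly4 set) set set" and u e
  proof -
    let ?W = "{g. fr g 1 \<in> I}"
    note bp = bracket_power_eq[OF ch I]
    have mem: "fr g s \<in> bracket_power hyp_local I q \<longleftrightarrow> (\<exists>v\<in>units. v * g \<in> bracket ?W q)"
      if "s \<in> units" for g s q
      unfolding bp bracket_def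
      using fr_extension_iff[OF ch P.subspace_span _ that] by (simp add: P.span_base)
    from u obtain c e\<^sub>0 where uc: "u \<in> carrier hyp_local" "c \<in> carrier hyp_local"
      and cP: "\<And>P. minimal_prime hyp_local P \<Longrightarrow> c \<notin> P"
      and ce: "\<And>e. e \<ge> e\<^sub>0 \<Longrightarrow> c \<otimes>\<^bsub>hyp_local\<^esub> u [^]\<^bsub>hyp_local\<^esub> ((3::nat) ^ e) \<in> bracket_power hyp_local I (3 ^ e)"
      unfolding tight_closure_def by blast
    obtain a s where a: "u = fr a s" "s \<in> units" using uc(1) by (rule fr_cases)
    obtain b t where b: "c = fr b t" "t \<in> units" using uc(2) by (rule fr_cases)
    have "c \<noteq> \<zero>\<^bsub>hyp_local\<^esub>" using cP[OF minimal_prime_zero[OF ch]] by blast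
    then have "\<not> hypf dvd b" unfolding b(1) fr_zero using b(2) by (subst (asm) fr_eq_iff[OF ch]) simp_all
    moreover have "b \<in> multipliers ?W a e\<^sub>0"
      unfolding multipliers_def
    proof (intro CollectI allI impI)
      fix e assume "e\<^sub>0 \<le> e"
      from ce[OF this] have "fr (b * a ^ 3 ^ e) (t * s ^ 3 ^ e) \<in> bracket_power hyp_local I (3 ^ e)"
        unfolding a(1) b(1) fr_power[OF a(2)] fr_mult[OF b(2) units_power[OF a(2)]] .
      then show "\<exists>v\<in>units. v * b * a ^ 3 ^ e \<in> bracket ?W (3 ^ e)"
        unfolding mem[OF units_mult[OF b(2) units_power[OF a(2)]]] by (simp add: mult.assoc)
    qed
    ultimately have "?c \<in> multipliers ?W a 0" using square_products_multipliers[OF ch] by blast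
    then have "\<exists>v\<in>units. v * (?c * a ^ 3 ^ e) \<in> bracket ?W (3 ^ e)"
      unfolding multipliers_def by (auto simp: mult.assoc)
    then show ?thesis
      unfolding a(1) fr_power[OF a(2)] fr_mult[OF units_one units_power[OF a(2)]]
        mem[OF units_mult[OF units_one units_power[OF a(2)]]] .
  qed
  then show ?thesis unfolding test_ideal_def using fr_carrier[OF units_one, of ?c] by blast
qed

lemma ideal_test_ideal:
  assumes "cring R"
  shows "ideal (test_ideal p R) R"
proof -
  interpret cring R by (rule assms)
  have pow: "u [^]\<^bsub>R\<^esub> n \<in> carrier R" if "u \<in> tight_closure p R I" for u I and n :: nat
    using that unfolding tight_closure_def by auto
  have br: "ideal (bracket_power R I q) R" if "ideal I R" for I q
    unfolding bracket_power_def
    using ideal.Icarr[OF that] by (intro genideal_ideal) auto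
  show ?thesis
  proof (rule idealI)
    show "subgroup (test_ideal p R) (add_monoid R)"
    proof (rule add.subgroupI)
      show "test_ideal p R \<subseteq> carrier R" unfolding test_ideal_def by blast
      have "\<zero>\<^bsub>R\<^esub> \<in> test_ideal p R"
        unfolding test_ideal_def
        using pow additive_subgroup.zero_closed[OF ideal.axioms(1)[OF br]] by auto
      then show "test_ideal p R \<noteq> {}" by blast
      show "\<ominus>\<^bsub>R\<^esub> a \<in> test_ideal p R" if "a \<in> test_ideal p R" for a
        using that pow additive_subgroup.a_inv_closed[OF ideal.axioms(1)[OF br]]
        unfolding test_ideal_def by (auto simp: l_minus)
      show "a \<oplus>\<^bsub>R\<^esub> b \<in> test_ideal p R" if "a \<in> test_ideal p R" "b \<in> test_ideal p R" for a b
        using that pow additive_subgroup.a_closed[OF ideal.axioms(1)[OF br]]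
        unfolding test_ideal_def by (auto simp: l_distr)
    qed
  next
    fix a x assume a: "a \<in> test_ideal p R" "x \<in> carrier R"
    then have "x \<otimes>\<^bsub>R\<^esub> a \<in> test_ideal p R"
      using pow ideal.I_l_closed[OF br] unfolding test_ideal_def by (auto simp: m_assoc)
    with a show "x \<otimes>\<^bsub>R\<^esub> a \<in> test_ideal p R" "a \<otimes>\<^bsub>R\<^esub> x \<in> test_ideal p R"
      by (simp_all add: m_comm test_ideal_def)
  qed (rule ring_axioms)
qed

text \<open>The witness is 1 with threshold \<open>e = 1\<close>: a prime ideal is proper, and
  Frobenius closure lies in tight closure.\<close>

lemma cube_in_tight_closure:
  fixes i :: 4
  assumes ch: "CHAR('k::field) = 3"
  defines "I \<equiv> extension (P.span (insert (hypf :: 'k poly4) {Var j ^ 2 | j. j \<noteq> i}))"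
  shows "fr (Var i ^ 3) 1 \<in> tight_closure 3 hyp_local I"
proof -
  interpret cring "hyp_local :: ('k poly4 set \<times> 'k poly4 set) set ring" by (rule cring_hyp_local)
  have I: "ideal I hyp_local" unfolding I_def by (rule ideal_extension[OF ch P.subspace_span])
  have "\<one>\<^bsub>hyp_local\<^esub> \<notin> Q" if "minimal_prime hyp_local Q" for Q :: "('k poly4 set \<times> 'k poly4 set) set set"
  proof -
    from that interpret primeideal Q "hyp_local :: ('k poly4 set \<times> 'k poly4 set) set ring"
      by (simp add: minimal_prime_def)
    show ?thesis using I_notcarr one_imp_carrier by blast
  qed
  moreover have "\<one>\<^bsub>hyp_local\<^esub> \<otimes>\<^bsub>hyp_local\<^esub> fr (Var i ^ 3) 1 [^]\<^bsub>hyp_local\<^esub> ((3::nat) ^ e) \<in> bracket_power hyp_local I (3 ^ e)"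
    if e: "e \<ge> 1" for e
  proof -
    have "Var j ^ 2 \<in> {g. fr g 1 \<in> I}" if "j \<noteq> i" for j
      unfolding I_def mem_Collect_eq by (rule fr_in_extension[OF P.span_base units_one]) (use that in blast)
    then have "P.span (insert hypf {(Var j ^ 2) ^ 3 ^ e | j. j \<noteq> i}) \<subseteq> bracket {g. fr g 1 \<in> I} (3 ^ e)"
      unfolding bracket_def by (intro P.span_mono) blast
    with cube_frobenius_closure[OF ch e, of i] have "(Var i ^ 3) ^ 3 ^ e \<in> bracket {g. fr g 1 \<in> I} (3 ^ e)" by blast
    then have "fr ((Var i ^ 3) ^ 3 ^ e) 1 \<in> bracket_power hyp_local I (3 ^ e)"
      unfolding bracket_power_eq[OF ch I] extension_def using units_one by blast
    then show ?thesis
      unfolding fr_power[OF units_one] power_one l_one[OF fr_carrier[OF units_one]] .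
  qed
  ultimately show ?thesis
    unfolding tight_closure_def using fr_carrier[OF units_one, of "Var i ^ 3"] one_closed by blast
qed

lemma bracket_power_1:
  assumes "cring R" "ideal I R"
  shows "bracket_power R I 1 \<subseteq> I"
proof -
  interpret cring R by (rule assms)
  have "{u [^]\<^bsub>R\<^esub> (1::nat) | u. u \<in> I} \<subseteq> I"
    using ideal.Icarr[OF assms(2)] by auto
  then show ?thesis unfolding bracket_power_def by (rule genideal_minimal[OF assms(2)])
qed

lemma test_ideal_carrier: "c \<in> test_ideal p R \<Longrightarrow> c \<in> carrier R"
  by (simp add: test_ideal_def)

lemma test_idealD:
  "c \<in> test_ideal p R \<Longrightarrow> ideal I R \<Longrightarrow> u \<in> tight_closure p R I \<Longrightarrow>
    c \<otimes>\<^bsub>R\<^esub> u [^]\<^bsub>R\<^esub> (p ^ e) \<in> bracket_power R I (p ^ e)"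
  by (simp add: test_ideal_def)

text \<open>The case \<open>q = 1\<close> of the test condition puts \<open>c\<close> into each
  colon ideal of \<open>x_i^3\<close>; \<open>cube_colon\<close> intersects the four.\<close>

lemma test_ideal_subset:
  assumes ch: "CHAR('k::field) = 3"
  shows "test_ideal 3 (hyp_local :: ('k poly4 set \<times> 'k poly4 set) set ring) \<subseteq>
    extension (P.span (insert hypf square_products))"
proof
  fix c assume c: "c \<in> test_ideal 3 (hyp_local :: ('k poly4 set \<times> 'k poly4 set) set ring)"
  then have "c \<in> carrier hyp_local" by (rule test_ideal_carrier)
  then obtain g s where g: "c = fr g s" "s \<in> units" by (rule fr_cases)
  have "\<exists>v\<in>units. v * (g * Var i ^ 3) \<in> P.span (insert hypf {Var j ^ 2 | j. j \<noteq> i})" (is "\<exists>v\<in>units. v * _ \<in> ?X") for i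
  proof -
    have I: "ideal (extension ?X) hyp_local" by (rule ideal_extension[OF ch P.subspace_span])
    have "c \<otimes>\<^bsub>hyp_local\<^esub> fr (Var i ^ 3) 1 [^]\<^bsub>hyp_local\<^esub> ((3::nat) ^ 0) \<in> bracket_power hyp_local (extension ?X) (3 ^ 0)"
      by (rule test_idealD[OF c I cube_in_tight_closure[OF ch]])
    moreover have "fr (Var i ^ 3) 1 [^]\<^bsub>hyp_local\<^esub> ((3::nat) ^ 0) = fr (Var i ^ 3 :: 'k poly4) 1"
      unfolding fr_power[OF units_one] by simp
    moreover have "bracket_power hyp_local (extension ?X) (3 ^ 0) \<subseteq> extension ?X"
      using bracket_power_1[OF cring_hyp_local I] by (simp only: power_0)
    ultimately have "fr (g * Var i ^ 3) (s * 1) \<in> extension ?X"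
      unfolding g(1) fr_mult[OF g(2) units_one, symmetric] by (simp only: subset_iff)
    then show ?thesis
      using fr_extension_iff[OF ch P.subspace_span _ units_mult[OF g(2) units_one]] P.span_base by blast
  qed
  then have "\<forall>i. \<exists>v. v \<in> units \<and> v * (g * Var i ^ 3) \<in> P.span (insert hypf {Var j ^ 2 | j. j \<noteq> i})"
    by blast
  from choice[OF this] obtain v where v: "\<And>i. v i \<in> units"
    "\<And>i. v i * (g * Var i ^ 3) \<in> P.span (insert hypf {Var j ^ 2 | j. j \<noteq> i})"
    by blast
  \<comment> \<open>A common multiple of the four denominators, so that one polynomial
    \<open>w * g\<close> lies in all four colon ideals.\<close>
  define w where "w = v 0 * v 1 * v 2 * v 3"
  have w: "w \<in> units" unfolding w_def by (intro units_mult v)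
  have ws: "w = (v 1 * v 2 * v 3) * v 0" "w = (v 0 * v 2 * v 3) * v 1"
    "w = (v 0 * v 1 * v 3) * v 2" "w = (v 0 * v 1 * v 2) * v 3"
    unfolding w_def by (simp_all only: mult_ac)
  have dvd: "\<forall>i. \<exists>z. w = z * v i" unfolding forall_4 by (intro conjI; rule exI; rule ws)
  have "(w * g) * Var i ^ 3 \<in> P.span (insert hypf {Var j ^ 2 | j. j \<noteq> i})" for i
  proof -
    obtain z where "w = z * v i" using dvd by blast
    then have "(w * g) * Var i ^ 3 = z * (v i * (g * Var i ^ 3))" by (simp only: mult_ac)
    then show ?thesis by (simp only: P.span_scale[OF v(2)])
  qed
  from cube_colon[OF this] have "w * g \<in> P.span (insert hypf square_products)"
    using P.span_mono[of square_products "insert hypf square_products"] by blast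
  then show "c \<in> extension (P.span (insert hypf square_products))"
    unfolding g(1) using fr_extension_iff[OF ch P.subspace_span _ g(2)] w P.span_base by blast
qed

theorem mainTheorem2:
  fixes R :: "('k::field poly4 set \<times> 'k poly4 set) set ring"
  assumes "CHAR('k) = 3"
    and "R = hyp_local"
  shows "test_ideal 3 R =
    Idl\<^bsub>R\<^esub> {local_var i [^]\<^bsub>R\<^esub> (2::nat) \<otimes>\<^bsub>R\<^esub> local_var j [^]\<^bsub>R\<^esub> (2::nat) | i j. True}"
proof -
  interpret cring "hyp_local :: ('k poly4 set \<times> 'k poly4 set) set ring" by (rule cring_hyp_local)
  have eq: "local_var i [^]\<^bsub>hyp_local\<^esub> (2::nat) \<otimes>\<^bsub>hyp_local\<^esub> local_var j [^]\<^bsub>hyp_local\<^esub> (2::nat) =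
      fr (Var i ^ 2 * Var j ^ 2 :: 'k poly4) 1" for i j
    unfolding local_var_eq fr_power[OF units_one] fr_mult[OF units_power[OF units_one] units_power[OF units_one]] by simp
  have gens: "{local_var i [^]\<^bsub>R\<^esub> (2::nat) \<otimes>\<^bsub>R\<^esub> local_var j [^]\<^bsub>R\<^esub> (2::nat) | i j. True} =
      {fr w 1 | w. w \<in> square_products}"
    unfolding assms(2) eq by blast
  have "{fr w 1 | w. w \<in> square_products} \<subseteq> test_ideal 3 (hyp_local :: ('k poly4 set \<times> 'k poly4 set) set ring)"
    using square_products_in_test_ideal[OF assms(1)] by blast
  then have "Idl\<^bsub>hyp_local\<^esub> {fr w 1 | w. w \<in> square_products} \<subseteq> test_ideal 3 (hyp_local :: ('k poly4 set \<times> 'k poly4 set) set ring)"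
    by (rule genideal_minimal[OF ideal_test_ideal[OF cring_hyp_local]])
  then have "extension (P.span (insert hypf square_products)) \<subseteq> test_ideal 3 (hyp_local :: ('k poly4 set \<times> 'k poly4 set) set ring)"
    unfolding genideal_fr[OF assms(1)] .
  from subset_antisym[OF test_ideal_subset[OF assms(1)] this] show ?thesis
    unfolding gens unfolding assms(2) genideal_fr[OF assms(1)] .
qed

end
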